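(* Let $d\ge1$, $n\ge2$ and $0\le k\le n$. The collections in the packet $\mathcal P(n,k)$ of $G(d,1,n)$ all have the same number of elements.
   Context: Group: for positive integers $d,n$, $G(d,1,n)$ is the group generated by $s_1,\dots,s_n$ with defining relations $s_n^d=1$; $s_i^2=1$ $(1\le i\le n-1)$; $s_is_j=s_js_i$ $(j+1<i\le n)$; $s_{i+1}s_is_{i+1}=s_is_{i+1}s_i$ $(1\le i\le n-2)$; $s_ns_{n-1}s_ns_{n-1}=s_{n-1}s_ns_{n-1}s_n$. Canonical words: words are elements of the free monoid on $\{s_1,\dots,s_n\}$. Put $s_{ij}=s_is_{i-1}\cdots s_j$ if $i>j$, $s_{ii}=s_i$, $s_{ij}=$ the empty word if $i<j$; and $s^{(k)}_{nj}=s_n^k s_{n-1,j}$ for $k\ge1$, $1\le j\le n$. Every element of $G(d,1,n)$ has a unique canonical (reduced) word $s_{1i_1}s_{2i_2}\cdots s_{n-1,i_{n-1}}\,s^{(k_1)}_{nj_1}\cdots s^{(k_\ell)}_{nj_\ell}$ with $1\le i_p\le p+1$ for $1\le p\le n-1$, $\ell\ge0$, $1\le j_1<\cdots<j_\ell\le n$, $1\le k_p\le d-1$. The set of canonical words is $\mathcal W(d,1,n)$. The left factor $s_{1i_1}\cdots s_{n-1,i_{n-1}}$ is the prefix and the right factor $s^{(k_1)}_{nj_1}\cdots s^{(k_\ell)}_{nj_\ell}$ is the suffix. Full commutativity: a reduced expression for $w$ is a word in the generators of minimal length representing $w$; $R(w)$ is the set of these. $w$ is fully commutative if any element of $R(w)$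 can be obtained from any other using only the commutations $s_is_j=s_js_i$ $(j+1<i\le n)$ on adjacent letters. A canonical word is fully commutative if the element it represents is. Collections: for a suffix $\boldsymbol w'$, the collection $\mathbf c^n_{\boldsymbol w'}$ is the set of fully commutative words in $\mathcal W(d,1,n)$ whose suffix is $\boldsymbol w'$. Packets: $\mathcal P(n,k)$, $0\le k\le n$, is the following set of collections (all exponents $t,t_i$ range over $1,\dots,d-1$). $\mathcal P(n,0)$: collections labeled by suffixes $s^{(t_1)}_{n1}s^{(t_2)}_{nj_2}\cdots s^{(t_\ell)}_{nj_\ell}$ with $\ell\ge2$ and $1<j_2<\cdots<j_\ell\le n$. $\mathcal P(n,k)$ for $1\le k\le n-2$: collections labeled by $s^{(t)}_{nk}$ or by $s^{(t_1)}_{n,k+1}s^{(t_2)}_{nj_2}\cdots s^{(t_\ell)}_{nj_\ell}$ with $\ell\ge2$ and $k+1<j_2<\cdots<j_\ell\le n$. $\mathcal P(n,n-1)$: collections labeled by $s_n^t$ or $s^{(t)}_{n,n-1}=s_n^ts_{n-1}$. $\mathcal P(n,n)$: only the collection labeled by the empty suffix. *)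

theory Defs
  imports "HOL-Algebra.Group"
begin

section \<open>Group presentations\<close>

text \<open>A signed word is a list of pairs \<open>(a, e)\<close> that stands for the product of the letters \<open>a\<close>
  (if \<open>e = True\<close>) or \<open>a\<inverse>\<close> (if \<open>e = False\<close>).  A relation \<open>l = r\<close> between positive words is given
  as the pair \<open>(l, r)\<close>.\<close>

type_synonym 'a signed_word = "('a \<times> bool) list"

definition signed_words :: "'a set \<Rightarrow> 'a signed_word set" where
  "signed_words X = lists (X \<times> UNIV)"

definition pos :: "'a list \<Rightarrow> 'a signed_word" where
  "pos w = map (\<lambda>a. (a, True)) w"

inductive pres_eq :: "'a set \<Rightarrow> ('a list \<times> 'a list) set \<Rightarrow> 'a signed_word \<Rightarrow> 'a signed_word \<Rightarrow> bool"
  for X :: "'a set" and R :: "('a list \<times> 'a list) set"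
where
  pres_refl: "u \<in> signed_words X \<Longrightarrow> pres_eq X R u u"
| pres_sym: "pres_eq X R u v \<Longrightarrow> pres_eq X R v u"
| pres_trans: "pres_eq X R u v \<Longrightarrow> pres_eq X R v w \<Longrightarrow> pres_eq X R u w"
| pres_cancel: "u \<in> signed_words X \<Longrightarrow> v \<in> signed_words X \<Longrightarrow> a \<in> X \<Longrightarrow>
    pres_eq X R (u @ [(a, e), (a, \<not> e)] @ v) (u @ v)"
| pres_rel: "u \<in> signed_words X \<Longrightarrow> v \<in> signed_words X \<Longrightarrow> (l, r) \<in> R \<Longrightarrow> l \<in> lists X \<Longrightarrow> r \<in> lists X \<Longrightarrow>
    pres_eq X R (u @ pos l @ v) (u @ pos r @ v)"

definition pres_class :: "'a set \<Rightarrow> ('a list \<times> 'a list) set \<Rightarrow> 'a signed_word \<Rightarrow> 'a signed_word set" where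
  "pres_class X R u = {v. pres_eq X R u v}"

definition presented_group ::
  "'a set \<Rightarrow> ('a list \<times> 'a list) set \<Rightarrow> 'a signed_word set monoid" where
  "presented_group X R =
    \<lparr>carrier = pres_class X R ` signed_words X,
     mult = (\<lambda>A B. \<Union>a\<in>A. \<Union>b\<in>B. pres_class X R (a @ b)),
     one = pres_class X R []\<rparr>"

lemma signed_words_append [simp]:
  "u @ v \<in> signed_words X \<longleftrightarrow> u \<in> signed_words X \<and> v \<in> signed_words X"
  by (auto simp: signed_words_def)

lemma signed_words_Nil [simp]: "[] \<in> signed_words X"
  by (simp add: signed_words_def)

lemma signed_words_Cons [simp]: "x # v \<in> signed_words X \<longleftrightarrow> fst x \<in> X \<and> v \<in> signed_words X"
  by (cases x) (auto simp: signed_words_def)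

lemma signed_words_pos [simp]: "pos w \<in> signed_words X \<longleftrightarrow> w \<in> lists X"
  by (auto simp: signed_words_def pos_def)

lemma pos_append [simp]: "pos (u @ v) = pos u @ pos v"
  by (simp add: pos_def)

lemma pres_eq_signed_words: "pres_eq X R u v \<Longrightarrow> u \<in> signed_words X \<and> v \<in> signed_words X"
  by (induction rule: pres_eq.induct) auto

lemma pres_eq_context:
  assumes "pres_eq X R u v" "p \<in> signed_words X" "q \<in> signed_words X"
  shows "pres_eq X R (p @ u @ q) (p @ v @ q)"
  using assms
proof (induction rule: pres_eq.induct)
  case (pres_refl u)
  then show ?case by (intro pres_eq.pres_refl) simp
next
  case (pres_sym u v)
  then show ?case by (intro pres_eq.pres_sym[OF pres_sym.IH])
next
  case (pres_trans u v w)
  then show ?case by (intro pres_eq.pres_trans[OF pres_trans.IH])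
next
  case (pres_cancel u v a e)
  then show ?case using pres_eq.pres_cancel[of "p @ u" X "v @ q" a R e] by simp
next
  case (pres_rel u v l r)
  then show ?case using pres_eq.pres_rel[of "p @ u" X "v @ q" l r R] by simp
qed

lemma pres_eq_append:
  assumes "pres_eq X R u u'" "pres_eq X R v v'"
  shows "pres_eq X R (u @ v) (u' @ v')"
proof -
  have "pres_eq X R (u @ v) (u' @ v)"
    using pres_eq_context[OF assms(1), of "[]" v] pres_eq_signed_words[OF assms(2)] by simp
  moreover have "pres_eq X R (u' @ v) (u' @ v')"
    using pres_eq_context[OF assms(2), of u' "[]"] pres_eq_signed_words[OF assms(1)] by simp
  ultimately show ?thesis by (rule pres_trans)
qed

lemma pres_class_eq_iff:
  assumes "u \<in> signed_words X"
  shows "pres_class X R u = pres_class X R v \<longleftrightarrow> pres_eq X R u v"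
proof
  assume "pres_class X R u = pres_class X R v"
  moreover have "u \<in> pres_class X R u"
    using assms by (simp add: pres_class_def pres_refl)
  ultimately have "u \<in> pres_class X R v" by simp
  then have "pres_eq X R v u" by (simp add: pres_class_def)
  then show "pres_eq X R u v" by (rule pres_sym)
next
  assume "pres_eq X R u v"
  then show "pres_class X R u = pres_class X R v"
    unfolding pres_class_def by (intro Collect_cong iffI) (rule pres_trans, erule pres_sym, assumption, rule pres_trans)
qed

lemma presented_group_mult:
  assumes "u \<in> signed_words X" "v \<in> signed_words X"
  shows "pres_class X R u \<otimes>\<^bsub>presented_group X R\<^esub> pres_class X R v = pres_class X R (u @ v)"
proof -
  have "pres_class X R (a @ b) = pres_class X R (u @ v)"
    if "a \<in> pres_class X R u" "b \<in> pres_class X R v" for a b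
  proof -
    from that have "pres_eq X R (u @ v) (a @ b)"
      by (simp add: pres_class_def pres_eq_append)
    then show ?thesis
      using assms pres_class_eq_iff[of "u @ v" X R "a @ b"] by simp
  qed
  moreover have "u \<in> pres_class X R u" "v \<in> pres_class X R v"
    using assms by (simp_all add: pres_class_def pres_refl)
  ultimately have "(\<Union>a\<in>pres_class X R u. \<Union>b\<in>pres_class X R v. pres_class X R (a @ b)) =
      pres_class X R (u @ v)"
    by blast
  then show ?thesis
    by (simp add: presented_group_def)
qed

lemma pres_inverse:
  "u \<in> signed_words X \<Longrightarrow> pres_eq X R (rev (map (\<lambda>(a, e). (a, \<not> e)) u) @ u) []"
proof (induction u)
  case Nil
  then show ?case by (simp add: pres_refl)
next
  case (Cons x u)
  obtain a e where x: "x = (a, e)" by (cases x)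
  let ?v = "rev (map (\<lambda>(a, e). (a, \<not> e)) u)"
  have *: "?v \<in> signed_words X" "u \<in> signed_words X" "a \<in> X"
    using Cons.prems x by (auto simp: signed_words_def in_lists_conv_set)
  from pres_cancel[OF this, of R "\<not> e"]
  have "pres_eq X R (rev (map (\<lambda>(a, e). (a, \<not> e)) (x # u)) @ x # u) (?v @ u)"
    by (simp add: x)
  then show ?case using Cons.IH[OF *(2)] by (rule pres_trans)
qed

lemma group_presented_group: "group (presented_group X R)"
proof (rule groupI)
  fix A assume "A \<in> carrier (presented_group X R)"
  then obtain u where u: "u \<in> signed_words X" "A = pres_class X R u"
    by (auto simp: presented_group_def)
  let ?v = "rev (map (\<lambda>(a, e). (a, \<not> e)) u)"
  have v: "?v \<in> signed_words X"
    using u(1) by (auto simp: signed_words_def in_lists_conv_set)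
  have "pres_class X R ?v \<otimes>\<^bsub>presented_group X R\<^esub> A = pres_class X R []"
    using presented_group_mult[OF v u(1)] pres_inverse[OF u(1)] u v
      pres_class_eq_iff[of "?v @ u" X R "[]"] by simp
  then show "\<exists>B\<in>carrier (presented_group X R). B \<otimes>\<^bsub>presented_group X R\<^esub> A = \<one>\<^bsub>presented_group X R\<^esub>"
    using v by (auto simp: presented_group_def)
next
  fix A assume "A \<in> carrier (presented_group X R)"
  then obtain u where u: "u \<in> signed_words X" "A = pres_class X R u"
    by (auto simp: presented_group_def)
  have "pres_class X R [] \<otimes>\<^bsub>presented_group X R\<^esub> A = A"
    using presented_group_mult[of "[]" X u] u by simp
  then show "\<one>\<^bsub>presented_group X R\<^esub> \<otimes>\<^bsub>presented_group X R\<^esub> A = A"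
    by (simp add: presented_group_def)
next
  fix A B assume "A \<in> carrier (presented_group X R)" "B \<in> carrier (presented_group X R)"
  then obtain u v where "u \<in> signed_words X" "A = pres_class X R u" "v \<in> signed_words X" "B = pres_class X R v"
    by (auto simp: presented_group_def)
  then show "A \<otimes>\<^bsub>presented_group X R\<^esub> B \<in> carrier (presented_group X R)"
    using presented_group_mult[of u X v R] by (auto simp: presented_group_def)
next
  fix A B C
  assume "A \<in> carrier (presented_group X R)" "B \<in> carrier (presented_group X R)"
    "C \<in> carrier (presented_group X R)"
  then obtain u v w where "u \<in> signed_words X" "A = pres_class X R u"
    "v \<in> signed_words X" "B = pres_class X R v" "w \<in> signed_words X" "C = pres_class X R w"
    by (auto simp: presented_group_def)
  then show "A \<otimes>\<^bsub>presented_group X R\<^esub> B \<otimes>\<^bsub>presented_group X R\<^esub> C =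
      A \<otimes>\<^bsub>presented_group X R\<^esub> (B \<otimes>\<^bsub>presented_group X R\<^esub> C)"
    by (simp add: presented_group_mult)
qed (auto simp: presented_group_def)

section \<open>The group \<open>G(d,1,n)\<close>\<close>

text \<open>The generator \<open>s\<^sub>i\<close> is represented by the index \<open>i \<in> {1..n}\<close>, and words are lists of indices.\<close>

definition gens :: "nat \<Rightarrow> nat set" where
  "gens n = {1..n}"

definition G_rels :: "nat \<Rightarrow> nat \<Rightarrow> (nat list \<times> nat list) set" where
  "G_rels d n =
     {(replicate d n, [])}
   \<union> {([i, i], []) | i. 1 \<le> i \<and> i + 1 \<le> n}
   \<union> {([i, j], [j, i]) | i j. 1 \<le> j \<and> j + 1 < i \<and> i \<le> n}
   \<union> {([i+1, i, i+1], [i, i+1, i]) | i. 1 \<le> i \<and> i + 2 \<le> n}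
   \<union> {([n, i, n, i], [i, n, i, n]) | i. 1 \<le> i \<and> i + 1 = n}"

definition G :: "nat \<Rightarrow> nat \<Rightarrow> nat signed_word set monoid" where
  "G d n = presented_group (gens n) (G_rels d n)"

definition element :: "nat \<Rightarrow> nat \<Rightarrow> nat list \<Rightarrow> nat signed_word set" where
  "element d n w = pres_class (gens n) (G_rels d n) (pos w)"

lemma element_append:
  "u \<in> lists (gens n) \<Longrightarrow> v \<in> lists (gens n) \<Longrightarrow>
    element d n (u @ v) = element d n u \<otimes>\<^bsub>G d n\<^esub> element d n v"
  by (simp add: element_def G_def presented_group_mult)

lemma element_carrier: "w \<in> lists (gens n) \<Longrightarrow> element d n w \<in> carrier (G d n)"
  by (auto simp: element_def G_def presented_group_def)

section \<open>Full commutativity\<close>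

definition reduced_expressions :: "nat \<Rightarrow> nat \<Rightarrow> nat signed_word set \<Rightarrow> nat list set" where
  "reduced_expressions d n g =
    {w \<in> lists (gens n). element d n w = g \<and>
       (\<forall>v \<in> lists (gens n). element d n v = g \<longrightarrow> length w \<le> length v)}"

inductive commutation :: "nat list \<Rightarrow> nat list \<Rightarrow> bool" where
  "j + 1 < i \<or> i + 1 < j \<Longrightarrow> commutation (u @ [i, j] @ v) (u @ [j, i] @ v)"

definition fully_commutative :: "nat \<Rightarrow> nat \<Rightarrow> nat signed_word set \<Rightarrow> bool" where
  "fully_commutative d n g \<longleftrightarrow>
    (\<forall>u \<in> reduced_expressions d n g. \<forall>v \<in> reduced_expressions d n g. commutation\<^sup>*\<^sup>* u v)"

section \<open>Canonical words\<close>

definition s_desc :: "nat \<Rightarrow> nat \<Rightarrow> nat list" where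
  "s_desc i j = rev [j..<Suc i]"

lemma s_desc_less: "i < j \<Longrightarrow> s_desc i j = []"
  and s_desc_same: "s_desc i i = [i]"
  and s_desc_greater: "j < i \<Longrightarrow> s_desc i j = i # s_desc (i - 1) j"
  by (auto simp: s_desc_def)

definition s_block :: "nat \<Rightarrow> nat \<Rightarrow> nat \<Rightarrow> nat list" where
  "s_block n k j = replicate k n @ s_desc (n - 1) j"

definition prefix_word :: "nat \<Rightarrow> (nat \<Rightarrow> nat) \<Rightarrow> nat list" where
  "prefix_word n i = concat (map (\<lambda>p. s_desc p (i p)) [1..<n])"

definition prefixes :: "nat \<Rightarrow> nat list set" where
  "prefixes n = {prefix_word n i | i. \<forall>p \<in> {1..<n}. 1 \<le> i p \<and> i p \<le> p + 1}"

text \<open>The suffix with exponents \<open>k\<^sub>1, \<dots>, k\<^sub>\<ell>\<close> and indices \<open>j\<^sub>1 < \<dots> < j\<^sub>\<ell>\<close> is encoded by the list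
  \<open>[(k\<^sub>1, j\<^sub>1), \<dots>, (k\<^sub>\<ell>, j\<^sub>\<ell>)]\<close>.\<close>

definition suffix_data :: "nat \<Rightarrow> nat \<Rightarrow> (nat \<times> nat) list set" where
  "suffix_data d n =
    {ps. sorted_wrt (<) (map snd ps) \<and> (\<forall>(k, j) \<in> set ps. 1 \<le> k \<and> k < d \<and> 1 \<le> j \<and> j \<le> n)}"

definition suffix_word :: "nat \<Rightarrow> (nat \<times> nat) list \<Rightarrow> nat list" where
  "suffix_word n ps = concat (map (\<lambda>(k, j). s_block n k j) ps)"

definition suffixes :: "nat \<Rightarrow> nat \<Rightarrow> nat list set" where
  "suffixes d n = suffix_word n ` suffix_data d n"

definition canonical_words :: "nat \<Rightarrow> nat \<Rightarrow> nat list set" where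
  "canonical_words d n = {u @ v | u v. u \<in> prefixes n \<and> v \<in> suffixes d n}"

section \<open>Collections and packets\<close>

text \<open>Prefixes do not contain \<open>s\<^sub>n\<close> and a nonempty suffix starts with \<open>s\<^sub>n\<close>, so the factorization of a
  canonical word into prefix and suffix is determined by the word.\<close>

definition collection :: "nat \<Rightarrow> nat \<Rightarrow> nat list \<Rightarrow> nat list set" where
  "collection d n v =
    {w \<in> canonical_words d n. fully_commutative d n (element d n w) \<and> (\<exists>u \<in> prefixes n. w = u @ v)}"

definition packet_labels :: "nat \<Rightarrow> nat \<Rightarrow> nat \<Rightarrow> (nat \<times> nat) list set" where
  "packet_labels d n k =
    (if k = 0 then
       {ps \<in> suffix_data d n. 2 \<le> length ps \<and> snd (hd ps) = 1}
     else if k + 2 \<le> n then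
       {[(t, k)] | t. 1 \<le> t \<and> t < d} \<union>
       {ps \<in> suffix_data d n. 2 \<le> length ps \<and> snd (hd ps) = k + 1}
     else if k + 1 = n then
       {[(t, n)] | t. 1 \<le> t \<and> t < d} \<union> {[(t, n - 1)] | t. 1 \<le> t \<and> t < d}
     else if k = n then {[]}
     else {})"

definition packet :: "nat \<Rightarrow> nat \<Rightarrow> nat \<Rightarrow> nat list set set" where
  "packet d n k = (\<lambda>ps. collection d n (suffix_word n ps)) ` packet_labels d n k"

lemma finite_prefixes: "finite (prefixes n)"
proof -
  have "prefix_word n i = prefix_word n (restrict i {1..<n})" for i
    unfolding prefix_word_def by (intro arg_cong[of _ _ concat] map_cong) auto
  moreover have "restrict i {1..<n} \<in> (\<Pi>\<^sub>E p\<in>{1..<n}. {1..p + 1})"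
    if "\<forall>p \<in> {1..<n}. 1 \<le> i p \<and> i p \<le> p + 1" for i
    using that by auto
  ultimately have "prefixes n \<subseteq> prefix_word n ` (\<Pi>\<^sub>E p\<in>{1..<n}. {1..p + 1})"
    unfolding prefixes_def by blast
  then show ?thesis
    by (rule finite_subset) (auto intro: finite_PiE)
qed

lemma finite_collection: "finite (collection d n v)"
  by (rule finite_subset[of _ "(\<lambda>u. u @ v) ` prefixes n"])
     (auto simp: collection_def finite_prefixes)

end

theory Submission
  imports Defs
begin

text \<open>Whether a canonical word is fully commutative can be read off from its prefix and its suffix, and
the resulting condition on the prefix is so simple that the prefixes can be counted.

Write the nonempty factors of a prefix as \<open>s\<^bsub>p i\<^esub>\<close> with \<open>p\<close> increasing, and let \<open>I\<close> be the set of their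
last indices \<open>i\<close>.  The prefix is fully commutative in the symmetric group iff the indices \<open>i\<close> increase
too (\<open>increasing_blocks\<close>), and then its right descents are the \<open>m \<in> I\<close> with \<open>m + 1 \<notin> I\<close>.  A suffix
\<open>v\<close> adds a condition on the descents only (\<open>admissible\<close>).  A descent \<open>m\<close> can be moved to the end of
the prefix; if \<open>v\<close> starts with \<open>s\<^sub>n\<^sup>t s\<^bsub>n-1,j\<^esub>\<close> and \<open>j \<le> m \<le> n - 2\<close>, it moves on to meet \<open>s\<^bsub>m+1\<^esub> s\<^sub>m\<close> in
\<open>v\<close> and creates a braid.  If \<open>v\<close> has at least two factors, then \<open>m = n - 1 \<ge> j\<close> also creates one,
namely \<open>s\<^bsub>n-1\<^esub> s\<^sub>n\<^sup>a s\<^bsub>n-1\<^esub> s\<^sub>n\<^sup>b = s\<^sub>n\<^sup>b s\<^bsub>n-1\<^esub> s\<^sub>n\<^sup>a s\<^bsub>n-1\<^esub>\<close>.  So a word is fully commutative only if it is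
admissible (\<open>fully_commutative_increasing\<close>, \<open>fully_commutative_admissible\<close>).

For the converse one needs to know all reduced words of an element.  The group acts on coloured
permutations, on which there is an explicit length function \<open>len\<close>.  A generator raises it by at most
one, and along a canonical word it rises at each letter (\<open>len_canonical_word\<close>).  Hence canonical words
are reduced, and removing the last letter of a reduced word lowers \<open>len\<close>.  In an admissible canonical
word every letter that can be removed in this way can be brought to the end by commutations alone, up to
which the rest is a shorter admissible canonical word (\<open>admissible_descent\<close>).  Induction on the length shows that every reduced
word of the element is commutation equivalent to the canonical one
(\<open>admissible_fully_commutative\<close>).

It remains to count increasing prefixes (\<open>card_single_eq_card_bounded\<close>).  The labels in \<open>\<P>(n,0)\<close> all
require \<open>I\<close> to be empty, and those in \<open>\<P>(n,n-1)\<close> require nothing.  Let \<open>1 \<le> k \<le> n - 2\<close>.  For the label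
\<open>s\<^sub>n\<^sup>t s\<^bsub>n-1,k\<^esub>\<close> the part of \<open>I\<close> in \<open>{k..n-1}\<close> must have the form \<open>{m..n-1}\<close>, and this forces the prefix to
end in \<open>s\<^sub>m s\<^bsub>m+1\<^esub> \<dots> s\<^bsub>n-1\<^esub>\<close>; for a label with at least two factors that starts at \<open>k + 1\<close> all elements of
\<open>I\<close> must be at most \<open>k\<close>.  Replacing the end \<open>s\<^sub>m s\<^bsub>m+1\<^esub> \<dots> s\<^bsub>n-1\<^esub>\<close> by the single factor \<open>s\<^bsub>m k\<^esub>\<close> is a bijection
between the two sets of prefixes; for \<open>m = n\<close> the end is empty and nothing is replaced.\<close>

section \<open>Coloured permutations and their length function\<close>

text \<open>The permutation that \<open>s\<^sub>p s\<^bsub>p-1\<^esub> \<dots> s\<^sub>i\<close> induces on positions: the value at \<open>p + 1\<close> moves down to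
position \<open>i\<close>.  In particular \<open>cyc i i\<close> transposes \<open>i\<close> and \<open>i + 1\<close>, and \<open>cyc p (p + 1)\<close> is the
identity.\<close>

definition cyc :: "nat \<Rightarrow> nat \<Rightarrow> nat \<Rightarrow> nat" where
  "cyc p i k = (if k = i then p + 1 else if i < k \<and> k \<le> p + 1 then k - 1 else k)"

text \<open>A pair \<open>(w, f)\<close> stands for the monomial matrix with permutation \<open>w\<close> and colour
\<open>f k \<in> {0..<d}\<close> in position \<open>k\<close>.  The generators act from the right: \<open>s\<^sub>i\<close> exchanges the positions
\<open>i\<close>, \<open>i + 1\<close> for \<open>i < n\<close>, and \<open>s\<^sub>n\<close> raises the colour in position \<open>n\<close>.\<close>

type_synonym coloured_perm = "(nat \<Rightarrow> nat) \<times> (nat \<Rightarrow> nat)"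

fun act :: "nat \<Rightarrow> nat \<Rightarrow> nat \<Rightarrow> coloured_perm \<Rightarrow> coloured_perm" where
  "act d n i (w, f) =
    (if i = n then (w, f(n := Suc (f n) mod d)) else (w \<circ> cyc i i, f \<circ> cyc i i))"

definition act_word :: "nat \<Rightarrow> nat \<Rightarrow> nat list \<Rightarrow> coloured_perm \<Rightarrow> coloured_perm" where
  "act_word d n u = fold (act d n) u"

definition start :: coloured_perm where
  "start = (id, \<lambda>_. 0)"

definition coloured_perms :: "nat \<Rightarrow> coloured_perm set" where
  "coloured_perms d = {(w, f). \<forall>k. f k < d}"

text \<open>Sorting the uncoloured positions increasingly, followed by the coloured ones
decreasingly, is the effect of the suffix; an inversion of the prefix permutation is then an inversion of
\<open>w\<close> with respect to this order.  For \<open>a < b\<close> position \<open>a\<close> comes first in the order iff \<open>a\<close> has colour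
\<open>0\<close>, whatever the colour of \<open>b\<close>.\<close>

definition inversion :: "coloured_perm \<Rightarrow> nat \<Rightarrow> nat \<Rightarrow> nat" where
  "inversion x a b =
    of_bool (if snd x a = 0 then fst x a > fst x b else fst x a < fst x b)"

text \<open>The length of the suffix factor \<open>s\<^sub>n\<^sup>t s\<^bsub>n-1,j\<^esub>\<close> that puts the colour \<open>t\<close> in position \<open>j\<close>.\<close>

definition colour_weight :: "nat \<Rightarrow> coloured_perm \<Rightarrow> nat \<Rightarrow> nat" where
  "colour_weight n x j = (if snd x j = 0 then 0 else snd x j + (n - j))"

definition len :: "nat \<Rightarrow> coloured_perm \<Rightarrow> nat" where
  "len n x = (\<Sum>(a, b) \<in> {(a, b). 1 \<le> a \<and> a < b \<and> b \<le> n}. inversion x a b)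
    + (\<Sum>j = 1..n. colour_weight n x j)"

lemma act_word_Nil [simp]: "act_word d n [] x = x"
  and act_word_append [simp]: "act_word d n (u @ v) x = act_word d n v (act_word d n u x)"
  and act_word_Cons [simp]: "act_word d n (i # u) x = act_word d n u (act d n i x)"
  by (simp_all add: act_word_def)

lemma cyc_involution: "cyc i i (cyc i i k) = k"
  by (auto simp: cyc_def)

lemma act_closed: "1 \<le> d \<Longrightarrow> x \<in> coloured_perms d \<Longrightarrow> act d n i x \<in> coloured_perms d"
  by (cases x) (auto simp: coloured_perms_def)

lemma act_word_closed: "1 \<le> d \<Longrightarrow> x \<in> coloured_perms d \<Longrightarrow> act_word d n u x \<in> coloured_perms d"
  by (induction u arbitrary: x) (simp_all add: act_closed)

lemma start_coloured_perms: "1 \<le> d \<Longrightarrow> start \<in> coloured_perms d"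
  by (simp add: start_def coloured_perms_def)

lemma act_power_n:
  "(act d n n ^^ m) (w, f) = (if m = 0 then (w, f) else (w, f(n := (f n + m) mod d)))"
  by (induction m) (auto simp: fun_eq_iff mod_Suc_eq)

lemma act_power_n_id:
  assumes "x \<in> coloured_perms d"
  shows "(act d n n ^^ d) x = x"
  using assms by (cases x) (auto simp: act_power_n coloured_perms_def)

lemma act_involution: "i \<noteq> n \<Longrightarrow> act d n i (act d n i x) = x"
  by (cases x) (auto simp: fun_eq_iff cyc_involution)

text \<open>The action of \<open>s\<^sub>n\<close> is invertible only when colours are reduced modulo \<open>d\<close>.\<close>

lemma act_inj:
  assumes "1 \<le> d" "x \<in> coloured_perms d" "y \<in> coloured_perms d" "act d n i x = act d n i y"
  shows "x = y"
proof (cases "i = n")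
  case False
  then show ?thesis using assms(4) act_involution by metis
next
  case True
  have "(act d n n ^^ (d - 1)) (act d n n x) = x" if "x \<in> coloured_perms d" for x
    using act_power_n_id[OF that, of n] assms(1)
    by (metis Suc_diff_1 Suc_le_eq funpow_Suc_right o_apply One_nat_def)
  then show ?thesis using assms True by metis
qed

lemma pairs_finite: "finite {(a, b). 1 \<le> a \<and> a < b \<and> b \<le> (n::nat)}"
  by (rule finite_subset[of _ "{1..n} \<times> {1..n}"]) auto

text \<open>The pairs other than \<open>{i, i + 1}\<close> are permuted among themselves by \<open>s\<^sub>i\<close>: their inversions
depend on the colour of the smaller position, and \<open>s\<^sub>i\<close> does not change which position of such a pair is the
smaller one.  So only the terms at \<open>i\<close> and \<open>i + 1\<close> can change.\<close>

lemma len_act_swap: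
  assumes "1 \<le> i" "i < n"
  shows "len n (act d n i x) + inversion x i (i + 1) + colour_weight n x i + colour_weight n x (i + 1)
    = len n x + inversion (act d n i x) i (i + 1)
      + colour_weight n (act d n i x) i + colour_weight n (act d n i x) (i + 1)"
proof -
  let ?y = "act d n i x"
  let ?c = "cyc i i"
  let ?T = "{(a, b). 1 \<le> a \<and> a < b \<and> b \<le> n}"
  let ?g = "\<lambda>(a, b). (?c a, ?c b)"
  have fs: "fst ?y a = fst x (?c a)" "snd ?y a = snd x (?c a)" for a
    using assms by (cases x; simp)+
  have "(\<Sum>(a, b) \<in> ?T - {(i, i + 1)}. inversion ?y a b)
      = (\<Sum>(a, b) \<in> ?T - {(i, i + 1)}. inversion x a b)"
    using assms
    by (intro sum.reindex_bij_witness[of _ ?g ?g])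
       (auto simp: cyc_def inversion_def fs split: if_splits)
  moreover have "(\<Sum>(a, b) \<in> ?T. inversion z a b)
      = inversion z i (i + 1) + (\<Sum>(a, b) \<in> ?T - {(i, i + 1)}. inversion z a b)" for z
    using assms using pairs_finite[of n] by (subst sum.remove[of _ "(i, i + 1)"]) auto
  moreover have "(\<Sum>j = 1..n. colour_weight n z j) = colour_weight n z i + colour_weight n z (i + 1)
      + (\<Sum>j \<in> {1..n} - {i, i + 1}. colour_weight n z j)" for z
    using assms sum.subset_diff[of "{i, i + 1}" "{1..n}" "colour_weight n z"]
    by simp
  moreover have "(\<Sum>j \<in> {1..n} - {i, i + 1}. colour_weight n ?y j)
      = (\<Sum>j \<in> {1..n} - {i, i + 1}. colour_weight n x j)"
    by (intro sum.cong) (auto simp: colour_weight_def fs cyc_def)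
  ultimately show ?thesis by (simp add: len_def)
qed

lemma len_act_n:
  assumes "1 \<le> n"
  shows "len n (act d n n x) + snd x n = len n x + Suc (snd x n) mod d"
proof -
  obtain w f where x: "x = (w, f)" by (cases x)
  let ?y = "act d n n x"
  have "(\<Sum>j = 1..n. colour_weight n z j) = colour_weight n z n
      + (\<Sum>j \<in> {1..n} - {n}. colour_weight n z j)" for z
    using assms by (subst sum.remove[of _ n]) auto
  moreover have "(\<Sum>j \<in> {1..n} - {n}. colour_weight n ?y j)
      = (\<Sum>j \<in> {1..n} - {n}. colour_weight n x j)"
    by (intro sum.cong) (auto simp: colour_weight_def x)
  moreover have "(\<Sum>(a, b) \<in> {(a, b). 1 \<le> a \<and> a < b \<and> b \<le> n}. inversion ?y a b)
      = (\<Sum>(a, b) \<in> {(a, b). 1 \<le> a \<and> a < b \<and> b \<le> n}. inversion x a b)"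
    by (intro sum.cong) (auto simp: inversion_def x)
  moreover have "colour_weight n z n = snd z n" for z
    by (simp add: colour_weight_def)
  ultimately show ?thesis
    by (simp add: len_def) (simp add: x)
qed

text \<open>If exactly one of the two positions is coloured, \<open>s\<^sub>i\<close> keeps the inversion and moves the
colour by one place; otherwise it keeps the total weight and reverses the comparison of the two values.  The
formula avoids subtraction by putting the loss on the left and the gain on the right.\<close>

lemma len_act_swap_cases:
  assumes "1 \<le> i" "i < n"
  shows "len n (act d n i x) + of_bool (if snd x i = 0 then snd x (i + 1) = 0 \<and> fst x i > fst x (i + 1)
        else snd x (i + 1) = 0 \<or> fst x i < fst x (i + 1))
    = len n x + of_bool (if snd x i = 0 then snd x (i + 1) > 0 \<or> fst x i < fst x (i + 1)
        else snd x (i + 1) > 0 \<and> fst x i > fst x (i + 1))"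
proof -
  obtain m where m: "n - i = Suc m" "n - Suc i = m" using assms by (metis Suc_diff_Suc)
  have "snd (act d n i x) i = snd x (i + 1)" "snd (act d n i x) (i + 1) = snd x i"
     "fst (act d n i x) i = fst x (i + 1)" "fst (act d n i x) (i + 1) = fst x i"
    using assms by (cases x; simp add: cyc_def)+
  then show ?thesis
    using len_act_swap[of i n d x] assms
    by (cases "snd x i = 0"; cases "snd x (i + 1) = 0")
       (simp_all add: inversion_def colour_weight_def m)
qed

lemma len_act_le:
  assumes "1 \<le> i" "i \<le> n"
  shows "len n (act d n i x) \<le> len n x + 1"
proof (cases "i = n")
  case True
  have "Suc (snd x n) mod d \<le> Suc (snd x n)" by (rule mod_less_eq_dividend)
  then show ?thesis using len_act_n[of n d x] assms unfolding True by linarith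
next
  case False
  have "l \<le> m + 1" if "l + of_bool P = m + of_bool Q" for l m :: nat and P Q
    using that by (cases P; cases Q) auto
  from this[OF len_act_swap_cases] show ?thesis using False assms by simp
qed

lemma len_act_up:
  assumes "1 \<le> i" "i < n" "snd x i = 0" "snd x (i + 1) > 0 \<or> fst x i < fst x (i + 1)"
  shows "len n (act d n i x) = len n x + 1"
  using len_act_swap_cases[of i n d x] assms by auto

lemma len_act_up_coloured:
  assumes "1 \<le> i" "i < n" "snd x i > 0" "snd x (i + 1) > 0" "fst x (i + 1) < fst x i"
  shows "len n (act d n i x) = len n x + 1"
  using len_act_swap_cases[of i n d x] assms by auto

lemma len_act_word_le:
  "u \<in> lists (gens n) \<Longrightarrow> len n (act_word d n u x) \<le> len n x + length u"
proof (induction u arbitrary: x)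
  case (Cons i u)
  then have "len n (act d n i x) \<le> len n x + 1"
    by (intro len_act_le) (auto simp: gens_def)
  then show ?case using Cons.IH[of "act d n i x"] Cons.prems by auto
qed simp

lemma len_start [simp]: "len n start = 0"
  by (auto simp: len_def start_def inversion_def colour_weight_def intro!: sum.neutral)

text \<open>Inverse letters must be interpreted as well, because the congruence of the presentation is
generated on signed words.  The generator \<open>s\<^sub>n\<close> has order \<open>d\<close> in the action, so its inverse is the power
\<open>d - 1\<close>.\<close>

fun act_signed :: "nat \<Rightarrow> nat \<Rightarrow> nat \<times> bool \<Rightarrow> coloured_perm \<Rightarrow> coloured_perm" where
  "act_signed d n (i, e) = (if e then act d n i else if i = n then act d n n ^^ (d - 1) else act d n i)"

lemma act_signed_closed:
  assumes "1 \<le> d" "x \<in> coloured_perms d"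
  shows "act_signed d n l x \<in> coloured_perms d"
proof -
  have "(act d n n ^^ m) x \<in> coloured_perms d" for m
    using assms by (induction m) (simp_all add: act_closed)
  then show ?thesis using assms by (cases l) (auto simp: act_closed)
qed

lemma fold_act_signed_closed:
  "1 \<le> d \<Longrightarrow> x \<in> coloured_perms d \<Longrightarrow> fold (act_signed d n) u x \<in> coloured_perms d"
  by (induction u arbitrary: x) (simp_all add: act_signed_closed)

lemma act_signed_cancel:
  assumes "1 \<le> d" "x \<in> coloured_perms d"
  shows "act_signed d n (a, \<not> e) (act_signed d n (a, e) x) = x"
proof -
  have "(act d n n ^^ (d - 1)) (act d n n x) = x" "act d n n ((act d n n ^^ (d - 1)) x) = x"
    using act_power_n_id[OF assms(2), of n] assms(1)
    by (metis Suc_diff_1 Suc_le_eq funpow_Suc_right o_apply One_nat_def,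
        metis Suc_diff_1 Suc_le_eq funpow.simps(2) o_apply One_nat_def)
  then show ?thesis by (auto simp: act_involution)
qed

lemma fold_act_signed_pos: "fold (act_signed d n) (pos u) = act_word d n u"
  by (induction u) (auto simp: pos_def act_word_def)

lemma act_word_replicate: "act_word d n (replicate m n) = act d n n ^^ m"
  by (induction m) (auto simp: act_word_def funpow_Suc_right simp del: funpow.simps)

lemma cyc_same: "cyc i i k = (if k = i then Suc i else if k = Suc i then i else k)"
  by (auto simp: cyc_def)

lemma cyc_commute:
  assumes "j + 1 < i \<or> i + 1 < j"
  shows "cyc i i (cyc j j k) = cyc j j (cyc i i k)"
  using assms by (cases "k = i \<or> k = Suc i"; cases "k = j \<or> k = Suc j") (auto simp: cyc_same)

lemma cyc_braid:
  "cyc (Suc i) (Suc i) (cyc i i (cyc (Suc i) (Suc i) k)) = cyc i i (cyc (Suc i) (Suc i) (cyc i i k))"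
  by (cases "k \<in> {i, Suc i, Suc (Suc i)}") (auto simp: cyc_same)

lemma act_commute:
  assumes "j + 1 < i \<or> i + 1 < j"
  shows "act d n i (act d n j x) = act d n j (act d n i x)"
proof -
  obtain w f where x: "x = (w, f)" by (cases x)
  consider "i = n" | "j = n" | "i \<noteq> n" "j \<noteq> n" by blast
  then show ?thesis
  proof cases
    case 1
    then have *: "cyc j j n = n" "cyc j j k = n \<longleftrightarrow> k = n" for k
      using assms by (auto simp: cyc_same)
    show ?thesis using 1 assms by (auto simp: x fun_eq_iff *)
  next
    case 2
    then have *: "cyc i i n = n" "cyc i i k = n \<longleftrightarrow> k = n" for k
      using assms by (auto simp: cyc_same)
    show ?thesis using 2 assms by (auto simp: x fun_eq_iff *)
  next
    case 3
    then show ?thesis using cyc_commute[OF assms] by (auto simp: x fun_eq_iff)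
  qed
qed

lemma act_word_rel:
  assumes "2 \<le> n" "x \<in> coloured_perms d" "(l, r) \<in> G_rels d n"
  shows "act_word d n l x = act_word d n r x"
proof -
  obtain w f where x: "x = (w, f)" by (cases x)
  consider "l = replicate d n" "r = []"
    | i where "1 \<le> i" "i + 1 \<le> n" "l = [i, i]" "r = []"
    | i j where "1 \<le> j" "j + 1 < i" "l = [i, j]" "r = [j, i]"
    | i where "1 \<le> i" "i + 2 \<le> n" "l = [i + 1, i, i + 1]" "r = [i, i + 1, i]"
    | i where "1 \<le> i" "i + 1 = n" "l = [n, i, n, i]" "r = [i, n, i, n]"
    using assms(3) unfolding G_rels_def by blast
  then show ?thesis
  proof cases
    case 1
    then show ?thesis using act_power_n_id[OF assms(2)] by (simp add: act_word_replicate)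
  next
    case 2
    then show ?thesis by (simp add: act_involution)
  next
    case 3
    then show ?thesis by (simp add: act_commute)
  next
    case 4
    then show ?thesis using cyc_braid[of i] by (simp add: x fun_eq_iff)
  next
    case 5
    then have "cyc i i k = (if k = i then n else if k = n then i else k)" for k
      by (auto simp: cyc_same)
    with 5 show ?thesis by (auto simp: x fun_eq_iff)
  qed
qed

lemma pres_eq_act:
  assumes "pres_eq (gens n) (G_rels d n) u v" "1 \<le> d" "2 \<le> n" "x \<in> coloured_perms d"
  shows "fold (act_signed d n) u x = fold (act_signed d n) v x"
  using assms
proof (induction arbitrary: x rule: pres_eq.induct)
  case (pres_cancel u v a e)
  then show ?case
    using act_signed_cancel[OF \<open>1 \<le> d\<close> fold_act_signed_closed] by simp
next
  case (pres_rel u v l r)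
  then show ?case
    using act_word_rel[OF \<open>2 \<le> n\<close> fold_act_signed_closed] by (simp add: fold_act_signed_pos)
qed auto

text \<open>The action factors through the presented group; this is how lower bounds for word lengths reach
the group.\<close>

lemma element_eq_act_word:
  assumes "element d n u = element d n v" "u \<in> lists (gens n)" "1 \<le> d" "2 \<le> n"
  shows "act_word d n u start = act_word d n v start"
proof -
  have "pres_eq (gens n) (G_rels d n) (pos u) (pos v)"
    using assms(1,2) by (simp add: element_def pres_class_eq_iff)
  from pres_eq_act[OF this assms(3,4) start_coloured_perms[OF assms(3)]]
  show ?thesis by (simp add: fold_act_signed_pos)
qed

section \<open>Canonical words have minimal length\<close>

lemma s_desc_split: "i \<le> Suc m \<Longrightarrow> m \<le> p \<Longrightarrow> s_desc p i = s_desc p (Suc m) @ s_desc m i"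
  using upt_add_eq_append[of i "Suc m" "p - m"] by (simp add: s_desc_def flip: rev_append)

lemma s_desc_snoc: "i \<le> p \<Longrightarrow> s_desc p i = s_desc p (Suc i) @ [i]"
  using s_desc_split[of i i p] by (simp add: s_desc_same)

lemma set_s_desc: "set (s_desc p i) = {i..p}"
  by (auto simp: s_desc_def)

lemma cyc_snoc: "i \<le> p \<Longrightarrow> cyc p (Suc i) \<circ> cyc i i = cyc p i"
  by (auto simp: fun_eq_iff cyc_def)

lemma cyc_trivial: "cyc p (Suc p) = id"
  by (auto simp: fun_eq_iff cyc_def)

lemma act_word_s_desc:
  assumes "i \<le> Suc p" "p < n"
  shows "act_word d n (s_desc p i) (w, f) = (w \<circ> cyc p i, f \<circ> cyc p i)"
  using assms(1)
proof (induction i rule: inc_induct)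
  case base
  then show ?case by (simp add: s_desc_less cyc_trivial)
next
  case (step i)
  then have i: "i \<le> p" "i \<noteq> n" using assms(2) by auto
  show ?case
    unfolding s_desc_snoc[OF i(1)] act_word_append step.IH cyc_snoc[OF i(1), symmetric]
    using i(2) by (simp add: comp_def)
qed

text \<open>A factor \<open>s\<^bsub>p i\<^esub>\<close> carries the entry at \<open>p + 1\<close> down to position \<open>i\<close>, past one entry per letter.  Each
step goes up if the entries passed are uncoloured and the travelling entry is either coloured or larger.\<close>

lemma len_s_desc:
  assumes "1 \<le> i" "i \<le> Suc p" "p < n"
    and "\<And>k. i \<le> k \<Longrightarrow> k \<le> p \<Longrightarrow> snd x k = 0 \<and> (snd x (p + 1) > 0 \<or> fst x k < fst x (p + 1))"
  shows "len n (act_word d n (s_desc p i) x) = len n x + length (s_desc p i)"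
  using assms(2,1,4)
proof (induction i rule: inc_induct)
  case base
  then show ?case by (simp add: s_desc_less)
next
  case (step i)
  obtain w f where x: "x = (w, f)" by (cases x)
  let ?y = "act_word d n (s_desc p (Suc i)) x"
  have i: "i \<le> p" "i < n" using step.hyps assms(3) by auto
  have y: "?y = (w \<circ> cyc p (Suc i), f \<circ> cyc p (Suc i))"
    unfolding x using i assms(3) by (intro act_word_s_desc) auto
  have "len n (act d n i ?y) = len n ?y + 1"
    using step.prems(1) i step.prems(2)[of i]
    by (intro len_act_up) (simp_all add: y[unfolded x] cyc_def x)
  moreover have "len n ?y = len n x + length (s_desc p (Suc i))"
    using step.IH step.prems by simp
  ultimately show ?case
    by (simp add: s_desc_snoc[OF i(1)])
qed

lemma act_word_replicate_n:
  assumes "f n = 0" "t < d"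
  shows "act_word d n (replicate t n) (w, f) = (w, f(n := t))"
  using assms by (auto simp: act_word_replicate act_power_n fun_eq_iff)

lemma len_replicate_n:
  assumes "f n = 0" "t < d" "1 \<le> n"
  shows "len n (act_word d n (replicate t n) (w, f)) = len n (w, f) + t"
  using assms(2)
proof (induction t)
  case (Suc t)
  let ?y = "act_word d n (replicate t n) (w, f)"
  have "len n (act d n n ?y) + snd ?y n = len n ?y + Suc (snd ?y n) mod d"
    by (rule len_act_n) fact
  moreover have "snd ?y n = t"
    using Suc.prems assms(1) by (simp add: act_word_replicate_n)
  moreover have "act_word d n (replicate (Suc t) n) (w, f) = act d n n ?y"
    by (simp only: act_word_replicate funpow.simps o_apply)
  ultimately show ?case using Suc by simp
qed simp

definition block_word :: "(nat \<times> nat) list \<Rightarrow> nat list" where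
  "block_word P = concat (map (\<lambda>(p, i). s_desc p i) P)"

text \<open>The nonempty factors of a prefix, \<open>(p, i)\<close> standing for \<open>s\<^bsub>p i\<^esub>\<close>.  Dropping the empty factors
makes the conditions on neighbouring factors easy to state.\<close>

definition prefix_blocks :: "nat \<Rightarrow> (nat \<times> nat) list set" where
  "prefix_blocks n = {P. sorted_wrt (\<lambda>x y. fst x < fst y) P \<and> (\<forall>(p, i) \<in> set P. 1 \<le> i \<and> i \<le> p \<and> p < n)}"

text \<open>The normal forms of the 321-avoiding permutations, which are the fully commutative elements of
the symmetric group.\<close>

definition increasing_blocks :: "nat \<Rightarrow> (nat \<times> nat) list set" where
  "increasing_blocks n = {P \<in> prefix_blocks n. sorted_wrt (\<lambda>x y. snd x < snd y) P}"

definition block_perm :: "(nat \<times> nat) list \<Rightarrow> nat \<Rightarrow> nat" where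
  "block_perm P = foldr (\<lambda>(p, i) g. cyc p i \<circ> g) P id"

lemma block_word_simps [simp]:
  "block_word [] = []" "block_word ((p, i) # P) = s_desc p i @ block_word P"
  "block_word (P @ Q) = block_word P @ block_word Q"
  by (simp_all add: block_word_def)

lemma block_perm_Nil [simp]: "block_perm [] = id"
  by (simp add: block_perm_def)

lemma block_perm_snoc: "block_perm (P @ [(p, i)]) = block_perm P \<circ> cyc p i"
proof -
  have "foldr (\<lambda>(p, i) g. cyc p i \<circ> g) P (h \<circ> h') = foldr (\<lambda>(p, i) g. cyc p i \<circ> g) P h \<circ> h'"
    for h h' :: "nat \<Rightarrow> nat"
    by (induction P) (auto simp: comp_assoc)
  from this[of id "cyc p i"] show ?thesis by (simp add: block_perm_def)
qed

lemma prefix_blocks_snoc: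
  "P @ [(p, i)] \<in> prefix_blocks n \<longleftrightarrow>
    P \<in> prefix_blocks n \<and> 1 \<le> i \<and> i \<le> p \<and> p < n \<and> (\<forall>(q, j) \<in> set P. q < p)"
  by (auto simp: prefix_blocks_def sorted_wrt_append)

lemma increasing_blocks_snoc:
  "P @ [(p, i)] \<in> increasing_blocks n \<longleftrightarrow>
    P \<in> increasing_blocks n \<and> 1 \<le> i \<and> i \<le> p \<and> p < n \<and> (\<forall>(q, j) \<in> set P. q < p \<and> j < i)"
  by (auto simp: increasing_blocks_def prefix_blocks_snoc sorted_wrt_append)

lemma prefix_blocksD: "P \<in> prefix_blocks n \<Longrightarrow> (p, i) \<in> set P \<Longrightarrow> 1 \<le> i \<and> i \<le> p \<and> p < n"
  by (auto simp: prefix_blocks_def)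

lemma act_block_word:
  assumes "P \<in> prefix_blocks n"
  shows "act_word d n (block_word P) start = (block_perm P, \<lambda>_. 0)"
  using assms
proof (induction P rule: rev_induct)
  case (snoc b P)
  then show ?case
    by (cases b) (auto simp: prefix_blocks_snoc block_perm_snoc act_word_s_desc comp_def)
qed (simp add: start_def)

lemma block_perm_fixes:
  "(\<And>q j. (q, j) \<in> set P \<Longrightarrow> j \<le> q \<and> q + 1 < k) \<Longrightarrow> block_perm P k = k"
proof (induction P rule: rev_induct)
  case (snoc b P)
  obtain p i where b: "b = (p, i)" by (cases b)
  then have "i \<le> p \<and> p + 1 < k" using snoc.prems[of p i] by simp
  then have "cyc p i k = k" by (simp add: cyc_def)
  then show ?case using snoc by (auto simp: b block_perm_snoc)
qed simp

lemma block_perm_le: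
  "(\<And>q j. (q, j) \<in> set P \<Longrightarrow> j \<le> q \<and> q + 1 \<le> K) \<Longrightarrow> k \<le> K \<Longrightarrow> block_perm P k \<le> K"
proof (induction P arbitrary: k rule: rev_induct)
  case (snoc b P)
  obtain p i where b: "b = (p, i)" by (cases b)
  then have "i \<le> p \<and> p + 1 \<le> K" using snoc.prems(1)[of p i] by simp
  then have "cyc p i k \<le> K" using snoc.prems(2) by (auto simp: cyc_def)
  then show ?case using snoc by (auto simp: b block_perm_snoc)
qed simp

text \<open>The factor \<open>s\<^bsub>p i\<^esub>\<close> moves the value \<open>p + 1\<close>, which the factors before it leave in position \<open>p + 1\<close>, past
smaller values.\<close>

lemma len_block_word:
  assumes "P \<in> prefix_blocks n"
  shows "len n (act_word d n (block_word P) start) = length (block_word P)"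
  using assms
proof (induction P rule: rev_induct)
  case (snoc b P)
  obtain p i where b: "b = (p, i)" by (cases b)
  have P: "P \<in> prefix_blocks n" and i: "1 \<le> i" "i \<le> p" "p < n" and less: "\<forall>(q, j) \<in> set P. q < p"
    using snoc.prems by (simp_all add: b prefix_blocks_snoc)
  have q: "j \<le> q \<and> q < p" if "(q, j) \<in> set P" for q j
    using prefix_blocksD[OF P that] less that by auto
  have "block_perm P (p + 1) = p + 1"
    by (rule block_perm_fixes) (use q in force)
  moreover have "block_perm P k \<le> p" if "k \<le> p" for k
    by (rule block_perm_le) (use q that in force)+
  ultimately have "len n (act_word d n (s_desc p i) (block_perm P, \<lambda>_. 0))
      = len n (block_perm P, \<lambda>_. 0) + length (s_desc p i)"
    using i by (intro len_s_desc) (auto simp: less_Suc_eq_le)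
  then show ?case using snoc.IH P by (simp add: b act_block_word)
qed simp

lemma suffix_word_Nil [simp]: "suffix_word n [] = []"
  and suffix_word_append [simp]: "suffix_word n (ps @ qs) = suffix_word n ps @ suffix_word n qs"
  and suffix_word_Cons [simp]:
    "suffix_word n ((t, j) # ps) = replicate t n @ s_desc (n - 1) j @ suffix_word n ps"
  by (simp_all add: suffix_word_def s_block_def)

lemma suffix_data_snoc:
  "ps @ [(t, j)] \<in> suffix_data d n \<longleftrightarrow>
    ps \<in> suffix_data d n \<and> 1 \<le> t \<and> t < d \<and> 1 \<le> j \<and> j \<le> n \<and> (\<forall>j' \<in> snd ` set ps. j' < j)"
  by (auto simp: suffix_data_def sorted_wrt_append)

text \<open>When a factor \<open>s\<^sub>n\<^sup>t s\<^bsub>n-1,j\<^esub>\<close> is appended, all colours present lie to the left of \<open>j\<close>.  So \<open>s\<^sub>n\<^sup>t\<close>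
colours an uncoloured entry, and this entry travels past uncoloured ones only.\<close>

lemma act_suffix_snoc:
  assumes "ps @ [(t, j)] \<in> suffix_data d n"
    and "\<And>k. snd (act_word d n (suffix_word n ps) x) k > 0 \<longleftrightarrow> k \<in> snd ` set ps"
  shows "fst (act_word d n (suffix_word n (ps @ [(t, j)])) x) =
      fst (act_word d n (suffix_word n ps) x) \<circ> cyc (n - 1) j" (is ?thesis1)
    and "snd (act_word d n (suffix_word n (ps @ [(t, j)])) x) =
      (snd (act_word d n (suffix_word n ps) x))(j := t)" (is ?thesis2)
    and "len n (act_word d n (suffix_word n (ps @ [(t, j)])) x) =
      len n (act_word d n (suffix_word n ps) x) + length (replicate t n @ s_desc (n - 1) j)" (is ?thesis3)
proof -
  obtain w f where y: "act_word d n (suffix_word n ps) x = (w, f)"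
    by (cases "act_word d n (suffix_word n ps) x")
  have j: "1 \<le> j" "j \<le> n" "1 \<le> t" "t < d" "\<And>j'. j' \<in> snd ` set ps \<Longrightarrow> j' < j"
    using assms(1) by (auto simp: suffix_data_snoc)
  have f0: "f k = 0" if "j \<le> k" for k
  proof -
    have "k \<notin> snd ` set ps" using j(5)[of k] that by auto
    then show ?thesis using assms(2)[of k] by (simp add: y)
  qed
  have r: "act_word d n (replicate t n) (w, f) = (w, f(n := t))"
    using j f0 by (intro act_word_replicate_n) auto
  have "act_word d n (suffix_word n (ps @ [(t, j)])) x = act_word d n (s_desc (n - 1) j) (w, f(n := t))"
    by (simp add: y r)
  moreover have "act_word d n (s_desc (n - 1) j) (w, f(n := t)) =
      (w \<circ> cyc (n - 1) j, f(n := t) \<circ> cyc (n - 1) j)"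
    using j by (intro act_word_s_desc) auto
  moreover have "f(n := t) \<circ> cyc (n - 1) j = f(j := t)"
    using j f0 by (auto simp: fun_eq_iff cyc_def)
  ultimately show ?thesis1 ?thesis2 by (simp_all add: y)
  have "len n (act_word d n (s_desc (n - 1) j) (w, f(n := t))) = len n (w, f(n := t)) + length (s_desc (n - 1) j)"
    using j f0 by (intro len_s_desc) auto
  moreover have "len n (w, f(n := t)) = len n (w, f) + t"
    using len_replicate_n[of f n t d w] j f0 by (simp add: r)
  ultimately show ?thesis3 by (simp add: y r)
qed

lemma suffix_colours:
  assumes "ps \<in> suffix_data d n" "snd x = (\<lambda>_. 0)"
  shows "snd (act_word d n (suffix_word n ps) x) k > 0 \<longleftrightarrow> k \<in> snd ` set ps"
  using assms
proof (induction ps arbitrary: k rule: rev_induct)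
  case (snoc b ps)
  obtain t j where b: "b = (t, j)" by (cases b)
  have "ps \<in> suffix_data d n" "1 \<le> t" using snoc.prems by (simp_all add: b suffix_data_snoc)
  then show ?case
    using act_suffix_snoc(2)[of ps t j d n x] snoc by (auto simp: b)
qed simp

lemma len_suffix_word:
  assumes "ps \<in> suffix_data d n" "snd x = (\<lambda>_. 0)"
  shows "len n (act_word d n (suffix_word n ps) x) = len n x + length (suffix_word n ps)"
  using assms
proof (induction ps rule: rev_induct)
  case (snoc b ps)
  obtain t j where b: "b = (t, j)" by (cases b)
  have ps: "ps \<in> suffix_data d n" using snoc.prems by (simp add: b suffix_data_snoc)
  have "ps @ [(t, j)] \<in> suffix_data d n" using snoc.prems(1) by (simp add: b)
  from act_suffix_snoc(3)[OF this suffix_colours[OF ps snoc.prems(2)]]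
  show ?case
    using snoc.IH[OF ps snoc.prems(2)] unfolding b by (simp del: act_word_append)
qed simp

lemma suffix_fixes:
  assumes "ps \<in> suffix_data d n" "snd x = (\<lambda>_. 0)" "\<And>j. j \<in> snd ` set ps \<Longrightarrow> k < j"
  shows "fst (act_word d n (suffix_word n ps) x) k = fst x k"
  using assms
proof (induction ps rule: rev_induct)
  case (snoc b ps)
  obtain t j where b: "b = (t, j)" by (cases b)
  have ps: "ps \<in> suffix_data d n" using snoc.prems by (simp add: b suffix_data_snoc)
  have "ps @ [(t, j)] \<in> suffix_data d n" using snoc.prems(1) by (simp add: b)
  from act_suffix_snoc(1)[OF this suffix_colours[OF ps snoc.prems(2)]]
  have "fst (act_word d n (suffix_word n (ps @ [b])) x) k = fst (act_word d n (suffix_word n ps) x) (cyc (n - 1) j k)"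
    by (simp add: b)
  moreover have "cyc (n - 1) j k = k" using snoc.prems(3)[of j] by (simp add: b cyc_def)
  ultimately show ?case
    using snoc.IH[OF ps snoc.prems(2)] snoc.prems(3) by simp
qed simp

text \<open>The order that the suffix imposes on positions: uncoloured ones increasing, then the coloured
ones decreasing.  It holds on a final segment \<open>{J..n}\<close> on which the permutation is increasing before the
suffix acts; the last assumption says that \<open>a\<close> comes before \<open>b\<close> in this order.\<close>

lemma suffix_order:
  assumes "ps \<in> suffix_data d n" "snd x = (\<lambda>_. 0)" "\<And>j. j \<in> snd ` set ps \<Longrightarrow> J \<le> j"
    and "\<And>a b. J \<le> a \<Longrightarrow> a < b \<Longrightarrow> b \<le> n \<Longrightarrow> fst x a < fst x b"
    and "J \<le> a" "a \<le> n" "J \<le> b" "b \<le> n"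
    and "if a \<in> snd ` set ps then b \<in> snd ` set ps \<and> b < a else b \<in> snd ` set ps \<or> a < b"
  shows "fst (act_word d n (suffix_word n ps) x) a < fst (act_word d n (suffix_word n ps) x) b"
  using assms
proof (induction ps arbitrary: a b rule: rev_induct)
  case (snoc c ps)
  obtain t j where c: "c = (t, j)" by (cases c)
  let ?N = "snd ` set ps"
  let ?c = "cyc (n - 1) j"
  have ps: "ps \<in> suffix_data d n" and less: "\<And>j'. j' \<in> ?N \<Longrightarrow> j' < j" and j: "1 \<le> j" "j \<le> n" "J \<le> j"
    using snoc.prems(1) snoc.prems(3)[of j] by (auto simp: c suffix_data_snoc)
  have "ps @ [(t, j)] \<in> suffix_data d n" using snoc.prems(1) by (simp add: c)
  from act_suffix_snoc(1)[OF this suffix_colours[OF ps snoc.prems(2)]]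
  have *: "fst (act_word d n (suffix_word n (ps @ [c])) x) k = fst (act_word d n (suffix_word n ps) x) (?c k)" for k
    by (simp add: c)
  have cN: "?c k \<in> ?N \<longleftrightarrow> k \<in> ?N" if "k \<noteq> j" for k
  proof (cases "k < j")
    case True
    then show ?thesis by (simp add: cyc_def)
  next
    case False
    then have "k \<notin> ?N" "k - 1 \<notin> ?N" using less[of k] less[of "k - 1"] that by (blast | linarith)+
    then show ?thesis using that by (simp only: cyc_def split: if_split) simp
  qed
  have cj: "?c j = n" "n \<notin> ?N" using j less[of n] by (auto simp: cyc_def)
  have range: "J \<le> ?c k \<and> ?c k \<le> n" if "J \<le> k" "k \<le> n" for k
    using that j by (auto simp: cyc_def)
  have less_n: "?c k < n" if "k \<noteq> j" "k \<le> n" for k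
    using that j by (auto simp: cyc_def)
  have mono: "?c k < ?c l" if "k < l" "k \<noteq> j" "l \<noteq> j" "l \<le> n" for k l
    using that j by (auto simp: cyc_def)
  have jN: "j \<notin> ?N" using less[of j] by auto
  have "if ?c a \<in> ?N then ?c b \<in> ?N \<and> ?c b < ?c a else ?c b \<in> ?N \<or> ?c a < ?c b"
    using snoc.prems(9) cN[of a] cN[of b] cj less_n[of a] less_n[of b] mono[of a b] mono[of b a]
      snoc.prems(6,8) less[of a] less[of b] jN
    by (cases "a = j"; cases "b = j") (auto simp: c split: if_splits)
  then show ?case unfolding *
    using snoc.prems range by (intro snoc.IH[OF ps]) (auto simp: c)
qed simp

section \<open>Prefixes and their permutations\<close>

lemma increasing_blocks_prefix: "P \<in> increasing_blocks n \<Longrightarrow> P \<in> prefix_blocks n"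
  by (simp add: increasing_blocks_def)

text \<open>In an increasing prefix the last indices of the factors are the excedance positions of the
permutation, and on the other positions it is increasing (the next two lemmas).  From this the descents
and the prefix itself are recovered.\<close>

lemma block_perm_top:
  assumes "P \<in> increasing_blocks n" "(p, i) \<in> set P"
  shows "block_perm P i = p + 1"
  using assms
proof (induction P rule: rev_induct)
  case (snoc b P)
  obtain q j where b: "b = (q, j)" by (cases b)
  have P: "P \<in> increasing_blocks n" and j: "j \<le> q" and less: "\<forall>(p, i) \<in> set P. p < q \<and> i < j"
    using snoc.prems(1) by (simp_all add: b increasing_blocks_snoc)
  show ?case
  proof (cases "(p, i) = b")
    case True
    have "block_perm P (q + 1) = q + 1"
      by (rule block_perm_fixes) (use less prefix_blocksD[OF increasing_blocks_prefix[OF P]] in force)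
    then show ?thesis using True by (simp add: b block_perm_snoc cyc_def)
  next
    case False
    then have "(p, i) \<in> set P" using snoc.prems by simp
    moreover from this have "cyc q j i = i" using less by (auto simp: cyc_def)
    ultimately show ?thesis using snoc.IH[OF P] by (simp add: b block_perm_snoc)
  qed
qed simp

lemma block_perm_non_top:
  assumes "P \<in> increasing_blocks n" "k \<notin> snd ` set P"
  shows "block_perm P k \<le> k"
  using assms
proof (induction P arbitrary: k rule: rev_induct)
  case (snoc b P)
  obtain q j where b: "b = (q, j)" by (cases b)
  have P: "P \<in> increasing_blocks n" and j: "j \<le> q" and less: "\<forall>(p, i) \<in> set P. p < q \<and> i < j"
    using snoc.prems(1) by (simp_all add: b increasing_blocks_snoc)
  have "k \<noteq> j" "k \<notin> snd ` set P" using snoc.prems(2) by (auto simp: b)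
  moreover have "k - 1 \<notin> snd ` set P" if "j < k" using less that by force
  ultimately have "cyc q j k \<notin> snd ` set P" "cyc q j k \<le> k" by (simp_all only: cyc_def) auto
  then show ?case using snoc.IH[OF P, of "cyc q j k"] by (simp add: b block_perm_snoc)
qed simp

lemma block_perm_mono_non_top:
  assumes "P \<in> increasing_blocks n" "a < b" "a \<notin> snd ` set P" "b \<notin> snd ` set P"
  shows "block_perm P a < block_perm P b"
  using assms
proof (induction P arbitrary: a b rule: rev_induct)
  case (snoc c P)
  obtain q j where c: "c = (q, j)" by (cases c)
  have P: "P \<in> increasing_blocks n" and j: "j \<le> q" and less: "\<forall>(p, i) \<in> set P. p < q \<and> i < j"
    using snoc.prems(1) by (simp_all add: c increasing_blocks_snoc)
  have *: "cyc q j k \<notin> snd ` set P" if "k \<noteq> j" "k \<notin> snd ` set P" for k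
  proof -
    have "k - 1 \<notin> snd ` set P" if "j < k" using less that by force
    then show ?thesis using that by (simp only: cyc_def) auto
  qed
  have ab: "a \<noteq> j" "b \<noteq> j" "a \<notin> snd ` set P" "b \<notin> snd ` set P"
    using snoc.prems(3,4) by (auto simp: c)
  then have "cyc q j a < cyc q j b" using \<open>a < b\<close> by (auto simp: cyc_def)
  then show ?case using snoc.IH[OF P _ *[OF ab(1,3)] *[OF ab(2,4)]] by (simp add: c block_perm_snoc)
qed simp

lemma increasing_blocks_order:
  assumes "P \<in> increasing_blocks n" "(p, i) \<in> set P" "(q, j) \<in> set P" "i < j"
  shows "p < q"
proof -
  have s: "sorted_wrt (\<lambda>x y. fst x < fst y \<and> snd x < snd y) P"
    using assms(1) by (auto simp: increasing_blocks_def prefix_blocks_def sorted_wrt_iff_nth_less)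
  from assms obtain a b where ab: "a < length P" "b < length P" "P ! a = (p, i)" "P ! b = (q, j)"
    by (metis in_set_conv_nth)
  consider "a < b" | "a = b" | "b < a" by linarith
  then show ?thesis
    using sorted_wrt_nth_less[OF s, of a b] sorted_wrt_nth_less[OF s, of b a] ab assms(4)
    by cases auto
qed

text \<open>Excedance values grow along \<open>I\<close> because the first indices of the factors do, a
non-excedance is at most its position, and off \<open>I\<close> the permutation increases.  So the only possible
descents are the \<open>m \<in> I\<close> with \<open>m + 1 \<notin> I\<close>.\<close>

lemma block_perm_ascent:
  assumes "P \<in> increasing_blocks n" "m \<in> snd ` set P \<Longrightarrow> m + 1 \<in> snd ` set P"
  shows "block_perm P m < block_perm P (m + 1)"
proof (cases "m + 1 \<in> snd ` set P")
  case True
  then obtain q where q: "(q, m + 1) \<in> set P" by auto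
  have top: "block_perm P (m + 1) = q + 1" "m + 1 \<le> q"
    using block_perm_top[OF assms(1) q] prefix_blocksD[OF increasing_blocks_prefix[OF assms(1)] q] by auto
  show ?thesis
  proof (cases "m \<in> snd ` set P")
    case True
    then obtain p where p: "(p, m) \<in> set P" by auto
    have "p < q" by (rule increasing_blocks_order[OF assms(1) p q]) simp
    then show ?thesis using top block_perm_top[OF assms(1) p] by simp
  next
    case False
    then show ?thesis using block_perm_non_top[OF assms(1) False] top by simp
  qed
next
  case False
  then show ?thesis using block_perm_mono_non_top[OF assms(1), of m "m + 1"] assms(2) by auto
qed

lemma set_increasing_blocks:
  assumes "P \<in> increasing_blocks n"
  shows "set P = {(p, i). block_perm P i = p + 1 \<and> i < block_perm P i}"
proof -
  have "(p, i) \<in> set P \<longleftrightarrow> block_perm P i = p + 1 \<and> i < block_perm P i" for p i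
  proof
    assume "(p, i) \<in> set P"
    then show "block_perm P i = p + 1 \<and> i < block_perm P i"
      using block_perm_top[OF assms] prefix_blocksD[OF increasing_blocks_prefix[OF assms]]
      by (simp add: less_Suc_eq_le)
  next
    assume *: "block_perm P i = p + 1 \<and> i < block_perm P i"
    then have "i \<in> snd ` set P" using block_perm_non_top[OF assms, of i] by (metis not_less)
    then obtain q where "(q, i) \<in> set P" by auto
    then show "(p, i) \<in> set P" using block_perm_top[OF assms, of q i] * by simp
  qed
  then show ?thesis by (simp add: set_eq_iff)
qed

lemma sorted_wrt_fst_unique:
  fixes P Q :: "('a::linorder \<times> 'b) list"
  assumes "sorted_wrt (\<lambda>x y. fst x < fst y) P" "sorted_wrt (\<lambda>x y. fst x < fst y) Q" "set P = set Q"
  shows "P = Q"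
  using assms
proof (induction P arbitrary: Q)
  case (Cons x P)
  then obtain y Q' where Q: "Q = y # Q'" by (cases Q) auto
  have "x \<in> set Q" "y \<in> set (x # P)" using Cons.prems(3) Q by auto
  then have xy: "x = y" using Cons.prems(1,2) Q by fastforce
  have "set P = set Q'" using Cons.prems Q xy by fastforce
  then show ?case using Cons Q xy by auto
qed simp

text \<open>Collections are sets of words, so counting them by their prefix data needs that the data are
determined by the word.  They are determined by the permutation, as its excedances.\<close>

lemma block_word_inj: "inj_on block_word (increasing_blocks n)"
proof (rule inj_onI)
  fix P Q assume P: "P \<in> increasing_blocks n" and Q: "Q \<in> increasing_blocks n"
    and eq: "block_word P = block_word Q"
  from act_block_word[OF increasing_blocks_prefix[OF P], of 0]
       act_block_word[OF increasing_blocks_prefix[OF Q], of 0]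
  have "block_perm P = block_perm Q" by (simp add: eq)
  then have "set P = set Q" using set_increasing_blocks[OF P] set_increasing_blocks[OF Q] by simp
  then show "P = Q"
    using P Q by (intro sorted_wrt_fst_unique) (auto simp: increasing_blocks_def prefix_blocks_def)
qed

lemma prefixes_eq_block_words: "prefixes n = block_word ` prefix_blocks n"
proof
  show "prefixes n \<subseteq> block_word ` prefix_blocks n"
  proof
    fix u assume "u \<in> prefixes n"
    then obtain i where u: "u = prefix_word n i" and i: "\<forall>p \<in> {1..<n}. 1 \<le> i p \<and> i p \<le> p + 1"
      by (auto simp: prefixes_def)
    let ?P = "map (\<lambda>p. (p, i p)) (filter (\<lambda>p. i p \<le> p) [1..<n])"
    have "concat (map (\<lambda>p. s_desc p (i p)) ps) = block_word (map (\<lambda>p. (p, i p)) (filter (\<lambda>p. i p \<le> p) ps))" for ps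
      by (induction ps) (auto simp: s_desc_less)
    then have "u = block_word ?P" by (simp add: u prefix_word_def)
    moreover have "sorted_wrt (\<lambda>p q. p < q) (filter (\<lambda>p. i p \<le> p) [1..<n])"
      by (intro sorted_wrt_filter) simp
    then have "?P \<in> prefix_blocks n"
      using i by (auto simp: prefix_blocks_def sorted_wrt_map)
    ultimately show "u \<in> block_word ` prefix_blocks n" by blast
  qed
  have "block_word P \<in> prefixes n" if "P \<in> prefix_blocks n" for P
    using that
  proof (induction n arbitrary: P)
    case 0
    then have "P = []" by (cases P) (auto simp: prefix_blocks_def)
    then show ?case by (auto simp: prefixes_def prefix_word_def)
  next
    case (Suc n)
    show ?case
    proof (cases "P \<in> prefix_blocks n")
      case True
      from Suc.IH[OF this] obtain i where i: "block_word P = prefix_word n i"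
        "\<forall>p \<in> {1..<n}. 1 \<le> i p \<and> i p \<le> p + 1" by (auto simp: prefixes_def)
      have "block_word P = prefix_word (Suc n) (i(n := n + 1))"
        unfolding i(1) prefix_word_def by (auto simp: s_desc_less intro!: arg_cong[of _ _ concat])
      then show ?thesis using i(2) unfolding prefixes_def
        by (intro CollectI exI[of _ "i(n := n + 1)"]) auto
    next
      case False
      then have "P \<noteq> []" by (auto simp: prefix_blocks_def)
      then obtain Q p j where P: "P = Q @ [(p, j)]" by (metis rev_exhaust surj_pair)
      have *: "Q \<in> prefix_blocks (Suc n)" "1 \<le> j" "j \<le> p" "p < Suc n" "\<forall>(q, j) \<in> set Q. q < p"
        using Suc.prems by (simp_all add: P prefix_blocks_snoc)
      have "p = n"
      proof (rule ccontr)
        assume "p \<noteq> n"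
        then have "Q @ [(p, j)] \<in> prefix_blocks n"
          using * by (auto simp: prefix_blocks_snoc) (auto simp: prefix_blocks_def)
        then show False using False P by simp
      qed
      then have "Q \<in> prefix_blocks n" using * by (auto simp: prefix_blocks_def)
      from Suc.IH[OF this] obtain i where i: "block_word Q = prefix_word n i"
        "\<forall>p \<in> {1..<n}. 1 \<le> i p \<and> i p \<le> p + 1" by (auto simp: prefixes_def)
      have "prefix_word n (i(n := j)) = prefix_word n i"
        unfolding prefix_word_def by (intro arg_cong[of _ _ concat] map_cong) auto
      moreover have "prefix_word (Suc n) i' = prefix_word n i' @ s_desc n (i' n)" for i'
        using * \<open>p = n\<close> by (simp add: prefix_word_def)
      ultimately have "block_word P = prefix_word (Suc n) (i(n := j))"
        by (simp add: P \<open>p = n\<close> i(1))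
      then show ?thesis using i(2) * \<open>p = n\<close> unfolding prefixes_def
        by (intro CollectI exI[of _ "i(n := j)"]) auto
    qed
  qed
  then show "block_word ` prefix_blocks n \<subseteq> prefixes n" by blast
qed

lemma set_block_word: "P \<in> prefix_blocks n \<Longrightarrow> block_word P \<in> lists (gens n)"
  by (fastforce simp: prefix_blocks_def block_word_def gens_def set_s_desc)

lemma set_suffix_word:
  assumes "ps \<in> suffix_data d n" "k \<in> set (suffix_word n ps)"
  shows "\<exists>(t, j) \<in> set ps. j \<le> k \<and> k \<le> n"
  using assms by (fastforce simp: suffix_data_def suffix_word_def s_block_def set_s_desc split: if_splits)

lemma suffix_word_gens: "ps \<in> suffix_data d n \<Longrightarrow> suffix_word n ps \<in> lists (gens n)"
  using set_suffix_word[of ps d n] by (fastforce simp: gens_def suffix_data_def)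

section \<open>Commutation classes\<close>

lemma commutation_context: "commutation\<^sup>*\<^sup>* u v \<Longrightarrow> commutation\<^sup>*\<^sup>* (p @ u @ q) (p @ v @ q)"
proof (induction rule: rtranclp_induct)
  case (step y z)
  from step.hyps(2) have "commutation (p @ y @ q) (p @ z @ q)"
  proof cases
    case (1 j i a b)
    then show ?thesis using commutation.intros[of j i "p @ a" "b @ q"] by simp
  qed
  then show ?case using step.IH by simp
qed simp

lemma commutation_append_right: "commutation\<^sup>*\<^sup>* u v \<Longrightarrow> commutation\<^sup>*\<^sup>* (u @ q) (v @ q)"
  using commutation_context[of u v "[]" q] by simp

lemma commutation_append_left: "commutation\<^sup>*\<^sup>* u v \<Longrightarrow> commutation\<^sup>*\<^sup>* (p @ u) (p @ v)"
  using commutation_context[of u v p "[]"] by simp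

lemma commutation_sym: "commutation\<^sup>*\<^sup>* u v \<Longrightarrow> commutation\<^sup>*\<^sup>* v u"
proof (induction rule: rtranclp_induct)
  case (step y z)
  from step.hyps(2) have "commutation z y"
    by cases (metis commutation.intros)
  then show ?case using step.IH by (rule converse_rtranclp_into_rtranclp)
qed simp

lemma commutation_move:
  "(\<And>j. j \<in> set v \<Longrightarrow> j + 1 < i \<or> i + 1 < j) \<Longrightarrow> commutation\<^sup>*\<^sup>* (i # v) (v @ [i])"
proof (induction v)
  case (Cons j v)
  have "commutation ([] @ [i, j] @ v) ([] @ [j, i] @ v)"
    using Cons.prems[of j] by (intro commutation.intros) auto
  moreover have "commutation\<^sup>*\<^sup>* (j # i # v) (j # v @ [i])"
    using commutation_append_left[OF Cons.IH, of "[j]"] Cons.prems by simp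
  ultimately show ?case by (auto intro: converse_rtranclp_into_rtranclp)
qed simp

lemma commutation_act_word:
  "commutation\<^sup>*\<^sup>* u v \<Longrightarrow> act_word d n u x = act_word d n v x"
proof (induction rule: rtranclp_induct)
  case (step y z)
  from step.hyps(2) have "act_word d n y x = act_word d n z x"
    by cases (metis act_commute act_word_Cons act_word_append append_Cons)
  then show ?case using step.IH by simp
qed simp

text \<open>Commutations preserve the number of each letter and the order of two neighbouring letters; these
invariants tell the two sides of a braid relation apart.\<close>

lemma commutation_count_list: "commutation\<^sup>*\<^sup>* u v \<Longrightarrow> count_list u k = count_list v k"
proof (induction rule: rtranclp_induct)
  case (step y z)
  from step.hyps(2) have "count_list y k = count_list z k" by cases simp
  then show ?case using step.IH by simp
qed simp

lemma commutation_length: "commutation\<^sup>*\<^sup>* u v \<Longrightarrow> length u = length v"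
proof (induction rule: rtranclp_induct)
  case (step y z)
  from step.hyps(2) have "length y = length z" by cases simp
  then show ?case using step.IH by simp
qed simp

lemma commutation_filter:
  "commutation\<^sup>*\<^sup>* u v \<Longrightarrow> filter (\<lambda>k. k = i \<or> k = Suc i) u = filter (\<lambda>k. k = i \<or> k = Suc i) v"
proof (induction rule: rtranclp_induct)
  case (step y z)
  from step.hyps(2) have "filter (\<lambda>k. k = i \<or> k = Suc i) y = filter (\<lambda>k. k = i \<or> k = Suc i) z"
    by cases auto
  then show ?case using step.IH by simp
qed simp

lemma commutation_set: "commutation\<^sup>*\<^sup>* u v \<Longrightarrow> set u = set v"
proof (induction rule: rtranclp_induct)
  case (step y z)
  from step.hyps(2) have "set y = set z" by cases auto
  then show ?case using step.IH by simp
qed simp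

lemma commutation_gens: "commutation\<^sup>*\<^sup>* u v \<Longrightarrow> u \<in> lists A \<longleftrightarrow> v \<in> lists A"
  using commutation_set[of u v] by (simp add: in_lists_conv_set)

section \<open>Admissible words are fully commutative\<close>

text \<open>The condition on the set \<open>I\<close> of last indices of an increasing prefix under which the suffix \<open>ps\<close>
creates no braid.  The second clause says that the prefix has no descent in \<open>{j..n-2}\<close>, the third one
that it has none in \<open>{j..n-1}\<close>: the largest element of \<open>I\<close> is always a descent.\<close>

fun admissible :: "nat \<Rightarrow> (nat \<times> nat) list \<Rightarrow> nat set \<Rightarrow> bool" where
  "admissible n [] I \<longleftrightarrow> True"
| "admissible n [(t, j)] I \<longleftrightarrow> (\<forall>i \<in> I. j \<le> i \<and> i + 2 \<le> n \<longrightarrow> i + 1 \<in> I)"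
| "admissible n ((t, j) # q # qs) I \<longleftrightarrow> (\<forall>i \<in> I. i < j)"

lemma commutation_swap_words:
  "(\<And>i j. i \<in> set u \<Longrightarrow> j \<in> set v \<Longrightarrow> j + 1 < i \<or> i + 1 < j) \<Longrightarrow> commutation\<^sup>*\<^sup>* (u @ v) (v @ u)"
proof (induction u)
  case (Cons i u)
  have "commutation\<^sup>*\<^sup>* ((i # u) @ v) ([i] @ v @ u)"
    using commutation_append_left[OF Cons.IH, of "[i]"] Cons.prems by simp
  also have "commutation\<^sup>*\<^sup>* \<dots> ((v @ [i]) @ u)"
    using commutation_append_right[OF commutation_move[of v i], of u] Cons.prems by simp
  finally show ?case by simp
qed simp

lemma set_block_word_ge: "k \<in> set (block_word P) \<Longrightarrow> \<exists>(q, j) \<in> set P. j \<le> k"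
  by (fastforce simp: block_word_def set_s_desc)

text \<open>The factors after \<open>s\<^bsub>p m\<^esub>\<close> have last indices at least \<open>m + 2\<close>, so all their letters commute with
\<open>s\<^sub>m\<close>.  Removing \<open>s\<^sub>m\<close> turns \<open>s\<^bsub>p m\<^esub>\<close> into \<open>s\<^bsub>p,m+1\<^esub>\<close>, which is empty if \<open>p = m\<close>.\<close>

lemma remove_descent:
  assumes "P \<in> increasing_blocks n" "m \<in> snd ` set P" "m + 1 \<notin> snd ` set P"
  obtains P' where "P' \<in> increasing_blocks n" "commutation\<^sup>*\<^sup>* (block_word P) (block_word P' @ [m])"
    "snd ` set P' \<subseteq> insert (m + 1) (snd ` set P)" "snd ` set P - {m} \<subseteq> snd ` set P'"
proof -
  obtain p where "(p, m) \<in> set P" using assms(2) by auto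
  then obtain A B where P: "P = A @ (p, m) # B" by (meson split_list)
  have m: "m \<le> p" using assms(1) by (auto simp: P increasing_blocks_def prefix_blocks_def)
  have B: "m + 2 \<le> j" if "(q, j) \<in> set B" for q j
  proof -
    have "m < j" "j \<noteq> m + 1"
      using assms(1,3) that by (force simp: P increasing_blocks_def sorted_wrt_append)+
    then show ?thesis by simp
  qed
  \<comment> \<open>the factor \<open>(p, m + 1)\<close> is not a legal block if it is empty, so it is left out for \<open>p = m\<close>\<close>
  let ?Q = "if m < p then [(p, m + 1)] else []"
  have Q: "block_word ?Q = s_desc p (Suc m)" using m by (auto simp: s_desc_less)
  have "A @ ?Q @ B \<in> increasing_blocks n"
    using assms(1) B by (fastforce simp: P increasing_blocks_def prefix_blocks_def sorted_wrt_append)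
  moreover have "commutation\<^sup>*\<^sup>* (m # block_word B) (block_word B @ [m])"
    using set_block_word_ge[of _ B] B by (intro commutation_move) fastforce
  from commutation_append_left[OF this, of "block_word A @ s_desc p (Suc m)"]
  have "commutation\<^sup>*\<^sup>* (block_word P) (block_word (A @ ?Q @ B) @ [m])"
    by (simp only: P block_word_simps Q s_desc_snoc[OF m] append.simps append_assoc)
  moreover have "snd ` set (A @ ?Q @ B) \<subseteq> insert (m + 1) (snd ` set P)"
    "snd ` set P - {m} \<subseteq> snd ` set (A @ ?Q @ B)"
    by (auto simp: P)
  ultimately show ?thesis using that by blast
qed

lemma admissible_remove_descent:
  assumes "admissible n ps I" "I' \<subseteq> insert (m + 1) I" "I - {m} \<subseteq> I'" "\<And>j. j \<in> snd ` set ps \<Longrightarrow> m + 1 < j"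
  shows "admissible n ps I'"
  using assms by (induction n ps I rule: admissible.induct) fastforce+

lemma admissible_Cons_Cons: "ps \<noteq> [] \<Longrightarrow> admissible n (p # ps) I \<longleftrightarrow> (\<forall>i \<in> I. i < snd p)"
  by (cases p; cases ps) auto

lemma admissible_butlast: "admissible n (ps @ [p]) I \<Longrightarrow> admissible n ps I"
proof (cases ps)
  case (Cons q qs)
  then show "admissible n (ps @ [p]) I \<Longrightarrow> admissible n ps I"
    by (cases q; cases "qs = []") (force simp: admissible_Cons_Cons)+
qed simp

lemma admissible_update:
  "admissible n (A @ (t, j) # B) I \<Longrightarrow> j \<le> j' \<Longrightarrow> admissible n (A @ (t', j') # B) I"
  by (cases A; cases "B = []") (force simp: admissible_Cons_Cons)+

lemma suffix_data_hd_le: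
  "(t, j) # ps \<in> suffix_data d n \<Longrightarrow> k \<in> snd ` set ((t, j) # ps) \<Longrightarrow> j \<le> k"
  by (auto simp: suffix_data_def)

lemma suffix_word_far:
  assumes "ps \<in> suffix_data d n" "\<And>j. j \<in> snd ` set ps \<Longrightarrow> m + 1 < j" "k \<in> set (suffix_word n ps)"
  shows "m + 1 < k"
  using set_suffix_word[OF assms(1,3)] assms(2) by force

lemma len_canonical_word:
  assumes "P \<in> prefix_blocks n" "ps \<in> suffix_data d n"
  shows "len n (act_word d n (block_word P @ suffix_word n ps) start) = length (block_word P @ suffix_word n ps)"
  using len_suffix_word[OF assms(2), of "act_word d n (block_word P) start"] len_block_word[OF assms(1)]
  by (simp add: act_block_word[OF assms(1)])

text \<open>The suffix moves two adjacent entries of the prefix permutation to the positions \<open>s\<close>, \<open>s + 1\<close>.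
If it has one factor, they come from \<open>s - 1\<close> and \<open>s\<close>, and admissibility says that \<open>s - 1\<close> is not a
descent; if it has more, the permutation increases from the first index of the suffix up to \<open>n\<close>.\<close>

lemma ascent_uncoloured:
  assumes "P \<in> increasing_blocks n" "ps \<in> suffix_data d n" "admissible n ps (snd ` set P)"
    and "s < n" "s \<notin> snd ` set ps" "s + 1 \<notin> snd ` set ps" "j \<in> snd ` set ps" "j < s"
  shows "fst (act_word d n (suffix_word n ps) (block_perm P, \<lambda>_. 0)) s
    < fst (act_word d n (suffix_word n ps) (block_perm P, \<lambda>_. 0)) (s + 1)"
proof -
  let ?I = "snd ` set P"
  obtain t J qs where ps: "ps = (t, J) # qs" using assms(7) by (cases ps) auto
  have "J \<le> j" using suffix_data_hd_le assms(2,7) unfolding ps by blast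
  show ?thesis
  proof (cases qs)
    case Nil
    then have J: "1 \<le> J" "J < s" using assms(2) \<open>J \<le> j\<close> \<open>j < s\<close> by (auto simp: ps suffix_data_def)
    have eq: "fst (act_word d n (suffix_word n ps) (block_perm P, \<lambda>_. 0)) = block_perm P \<circ> cyc (n - 1) J"
      using act_suffix_snoc(1)[of "[]" t J d n "(block_perm P, \<lambda>_. 0)"] assms(2) by (simp add: ps Nil)
    have "\<forall>i \<in> ?I. J \<le> i \<and> i + 2 \<le> n \<longrightarrow> i + 1 \<in> ?I"
      using assms(3) by (simp only: ps Nil admissible.simps)
    from bspec[OF this, of "s - 1"] have "s \<in> ?I" if "s - 1 \<in> ?I"
      using assms(4) J that by simp
    then have "block_perm P (s - 1) < block_perm P (s - 1 + 1)"
      using J by (intro block_perm_ascent[OF assms(1)]) simp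
    then show ?thesis unfolding eq using J \<open>s < n\<close> by (simp add: cyc_def)
  next
    case (Cons q qs')
    then have I: "i < J" if "i \<in> ?I" for i using assms(3) that by (cases q) (auto simp: ps)
    show ?thesis
    proof (rule suffix_order[OF assms(2), of _ J])
      fix a b assume "J \<le> a" "a < b"
      then show "fst (block_perm P, \<lambda>_. 0) a < fst (block_perm P, \<lambda>_. 0) b"
        using I[of a] I[of b] block_perm_mono_non_top[OF assms(1), of a b] by fastforce
    next
      fix j assume "j \<in> snd ` set ps"
      then show "J \<le> j" using suffix_data_hd_le[of t J qs d n] assms(2) by (simp add: ps)
    qed (use assms(4-8) \<open>J \<le> j\<close> in simp_all)
  qed
qed

text \<open>Two coloured positions require at least two suffix factors, so the prefix permutation increases
from the first index of the suffix up to \<open>n\<close>, and the suffix reverses the order of coloured positions.\<close>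

lemma ascent_coloured:
  assumes "P \<in> increasing_blocks n" "ps \<in> suffix_data d n" "admissible n ps (snd ` set P)"
    and "s < n" "s \<in> snd ` set ps" "s + 1 \<in> snd ` set ps"
  shows "fst (act_word d n (suffix_word n ps) (block_perm P, \<lambda>_. 0)) (s + 1)
    < fst (act_word d n (suffix_word n ps) (block_perm P, \<lambda>_. 0)) s"
proof -
  let ?I = "snd ` set P"
  obtain t J q qs where ps: "ps = (t, J) # q # qs"
    using assms(5,6) by (cases ps; cases "tl ps") auto
  have "J \<le> s" using suffix_data_hd_le assms(2,5) unfolding ps by blast
  have I: "i < J" if "i \<in> ?I" for i using assms(3) that by (cases q) (auto simp: ps)
  show ?thesis
  proof (rule suffix_order[OF assms(2), of _ J])
    fix a b assume "J \<le> a" "a < b"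
    then show "fst (block_perm P, \<lambda>_. 0) a < fst (block_perm P, \<lambda>_. 0) b"
      using I[of a] I[of b] block_perm_mono_non_top[OF assms(1), of a b] by fastforce
  next
    fix j assume "j \<in> snd ` set ps"
    then show "J \<le> j" using suffix_data_hd_le[of t J "q # qs" d n] assms(2) by (simp add: ps)
  qed (use assms(4-6) \<open>J \<le> s\<close> in simp_all)
qed

text \<open>Admissible words are closed under removing a letter that lowers the length, and the removed letter
can be restored at the end of the word up to commutations.  For \<open>s = n\<close> the last factor loses one
\<open>s\<^sub>n\<close>.  For \<open>s < n\<close> the colours in positions \<open>s\<close>, \<open>s + 1\<close> decide: if only \<open>s\<close> is coloured, a suffix factor
loses its last letter; if neither is and the suffix lies to the right of \<open>s + 1\<close>, then \<open>s\<close> is a descent of the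
prefix and commutes with the whole suffix; in the other cases the letter would raise the length.\<close>

lemma admissible_descent:
  assumes "P \<in> increasing_blocks n" "ps \<in> suffix_data d n" "admissible n ps (snd ` set P)"
    and "1 \<le> s" "s \<le> n"
    and eq: "act d n s x = act_word d n (block_word P @ suffix_word n ps) start"
    and len: "len n (act d n s x) = len n x + 1"
  obtains P' ps' where "P' \<in> increasing_blocks n" "ps' \<in> suffix_data d n" "admissible n ps' (snd ` set P')"
    "commutation\<^sup>*\<^sup>* ((block_word P' @ suffix_word n ps') @ [s]) (block_word P @ suffix_word n ps)"
proof -
  let ?N = "snd ` set ps"
  let ?I = "snd ` set P"
  let ?y = "act_word d n (suffix_word n ps) (block_perm P, \<lambda>_. 0)"
  have y: "act d n s x = ?y"
    using eq by (simp add: act_block_word[OF increasing_blocks_prefix[OF assms(1)]])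
  have colour: "snd ?y k > 0 \<longleftrightarrow> k \<in> ?N" for k
    by (rule suffix_colours[OF assms(2)]) simp
  show ?thesis
  proof (cases "s = n")
    case True
    have "snd (act d n n x) n = Suc (snd x n) mod d" by (cases x) simp
    then have "snd ?y n > 0"
      using len_act_n[of n d x] len assms(4,5) y True by simp
    then obtain t where "(t, n) \<in> set ps" using colour[of n] by auto
    then obtain A B where "ps = A @ (t, n) # B" by (meson split_list)
    moreover have "B = []"
      using assms(2) calculation by (cases B) (auto simp: suffix_data_def sorted_wrt_append)
    ultimately have ps: "ps = A @ [(t, n)]" by simp
    have A: "A \<in> suffix_data d n" "1 \<le> t" "t < d" "1 \<le> n" "\<forall>j' \<in> snd ` set A. j' < n"
      using assms(2) by (auto simp: ps suffix_data_snoc)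
    have desc: "s_desc (n - Suc 0) n = []" using A(4) by (intro s_desc_less) simp
    show ?thesis
    proof (cases "t = 1")
      case True
      have "admissible n A ?I"
        using assms(3) unfolding ps by (rule admissible_butlast)
      then show ?thesis
        using that[of P A] assms(1) A(1) True \<open>s = n\<close> by (simp add: ps desc)
    next
      case False
      then obtain t' where t: "t = Suc t'" "1 \<le> t'" using A(2) by (cases t) auto
      have "A @ [(t', n)] \<in> suffix_data d n" using A t by (simp add: suffix_data_snoc)
      moreover have "admissible n (A @ [(t', n)]) ?I"
        using assms(3) unfolding ps by (rule admissible_update) simp
      ultimately show ?thesis
        using that[of P "A @ [(t', n)]"] assms(1) \<open>s = n\<close>
        by (simp add: ps desc t replicate_append_same)
    qed
  next
    case False
    then have s: "1 \<le> s" "s < n" using assms(4,5) by auto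
    have up: "len n (act d n s ?y) \<noteq> len n ?y + 1"
      unfolding y[symmetric] act_involution[OF False] using len by linarith
    consider "s \<in> ?N" "s + 1 \<notin> ?N" | "s \<notin> ?N" "s + 1 \<in> ?N" | "s \<in> ?N" "s + 1 \<in> ?N"
      | "s \<notin> ?N" "s + 1 \<notin> ?N" "\<And>j. j \<in> ?N \<Longrightarrow> s + 1 < j"
      | j where "s \<notin> ?N" "s + 1 \<notin> ?N" "j \<in> ?N" "j < s"
      by (metis linorder_less_linear less_Suc_eq Suc_eq_plus1)
    then show ?thesis
    proof cases
      case 1
      then obtain t where "(t, s) \<in> set ps" by auto
      then obtain A B where ps: "ps = A @ (t, s) # B" by (meson split_list)
      let ?ps = "A @ (t, s + 1) # B"
      have B: "s + 1 < j" if "j \<in> snd ` set B" for j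
      proof -
        have "s < j" using assms(2) that by (auto simp: ps suffix_data_def sorted_wrt_append)
        moreover have "j \<noteq> s + 1" using 1(2) that unfolding ps set_append list.set image_Un image_insert by blast
        ultimately show ?thesis by simp
      qed
      have ps': "?ps \<in> suffix_data d n"
        using assms(2) B s by (fastforce simp: ps suffix_data_def sorted_wrt_append)
      have "B \<in> suffix_data d n"
        using assms(2) by (auto simp: ps suffix_data_def sorted_wrt_append)
      then have "commutation\<^sup>*\<^sup>* (suffix_word n B @ [s]) (s # suffix_word n B)"
        using suffix_word_far[of B d n s] B by (intro commutation_sym[OF commutation_move]) blast
      from commutation_append_left[OF this, of "block_word P @ suffix_word n A @ replicate t n @ s_desc (n - 1) (s + 1)"]
      have "commutation\<^sup>*\<^sup>* ((block_word P @ suffix_word n ?ps) @ [s]) (block_word P @ suffix_word n ps)"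
        using s_desc_snoc[of s "n - 1"] s by (simp add: ps)
      moreover have "admissible n ?ps ?I"
        using assms(3) unfolding ps by (rule admissible_update) simp
      ultimately show ?thesis by (intro that[OF assms(1) ps'])
    next
      case 2
      then have "len n (act d n s ?y) = len n ?y + 1"
        using colour s by (intro len_act_up) blast+
      then show ?thesis using up by blast
    next
      case 3
      then have "len n (act d n s ?y) = len n ?y + 1"
        using ascent_coloured[OF assms(1-3) s(2)] colour s by (intro len_act_up_coloured) blast+
      then show ?thesis using up by blast
    next
      case 4
      have fix_s: "fst ?y k = block_perm P k" if "k \<le> s + 1" for k
        using suffix_fixes[OF assms(2), of "(block_perm P, \<lambda>_. 0)" k] 4(3) that by fastforce
      have "\<not> block_perm P s < block_perm P (s + 1)"
        using len_act_up[of s n ?y d] s colour[of s] 4(1) up fix_s[of s] fix_s[of "s + 1"] by auto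
      then have "s \<in> ?I" "s + 1 \<notin> ?I" using block_perm_ascent[OF assms(1), of s] by blast+
      from remove_descent[OF assms(1) this] obtain P' where P': "P' \<in> increasing_blocks n"
        "commutation\<^sup>*\<^sup>* (block_word P) (block_word P' @ [s])"
        "snd ` set P' \<subseteq> insert (s + 1) ?I" "?I - {s} \<subseteq> snd ` set P'" .
      have adm: "admissible n ps (snd ` set P')"
        by (rule admissible_remove_descent[OF assms(3) P'(3,4)]) (use 4(3) in auto)
      have "commutation\<^sup>*\<^sup>* (suffix_word n ps @ [s]) (s # suffix_word n ps)"
        using suffix_word_far[OF assms(2), of s] 4(3) by (intro commutation_sym[OF commutation_move]) blast
      from commutation_append_left[OF this, of "block_word P'"]
      have "commutation\<^sup>*\<^sup>* ((block_word P' @ suffix_word n ps) @ [s]) ((block_word P' @ [s]) @ suffix_word n ps)"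
        by simp
      also have "commutation\<^sup>*\<^sup>* \<dots> (block_word P @ suffix_word n ps)"
        by (rule commutation_append_right[OF commutation_sym[OF P'(2)]])
      finally show ?thesis by (rule that[OF P'(1) assms(2) adm])
    next
      case 5
      then have "len n (act d n s ?y) = len n ?y + 1"
        using ascent_uncoloured[OF assms(1-3) s(2) 5] colour s by (intro len_act_up) blast+
      then show ?thesis using up by blast
    qed
  qed
qed

text \<open>By induction on the length: the last letter of a word whose length equals its \<open>len\<close> lowers \<open>len\<close>
when removed, so it can be split off from the canonical word too.\<close>

lemma commutation_admissible:
  assumes "1 \<le> d" "P \<in> increasing_blocks n" "ps \<in> suffix_data d n" "admissible n ps (snd ` set P)"
    and "w \<in> lists (gens n)" "act_word d n w start = act_word d n (block_word P @ suffix_word n ps) start"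
    and "len n (act_word d n w start) = length w"
  shows "commutation\<^sup>*\<^sup>* w (block_word P @ suffix_word n ps)"
  using assms(2-)
proof (induction w arbitrary: P ps rule: rev_induct)
  case Nil
  then show ?case
    using len_canonical_word[OF increasing_blocks_prefix[OF Nil.prems(1)] Nil.prems(2)] by simp
next
  case (snoc s w)
  let ?x = "act_word d n w start"
  have s: "1 \<le> s" "s \<le> n" and w: "w \<in> lists (gens n)" using snoc.prems(4) by (auto simp: gens_def)
  have eq: "act d n s ?x = act_word d n (block_word P @ suffix_word n ps) start"
    using snoc.prems(5) by simp
  have "len n (act d n s ?x) = length w + 1" using snoc.prems(6) by simp
  moreover have "len n ?x \<le> length w" using len_act_word_le[OF w, of d start] by simp
  moreover have "len n (act d n s ?x) \<le> len n ?x + 1" by (rule len_act_le[OF s])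
  ultimately have len: "len n (act d n s ?x) = len n ?x + 1" "len n ?x = length w" by auto
  obtain P' ps' where *: "P' \<in> increasing_blocks n" "ps' \<in> suffix_data d n" "admissible n ps' (snd ` set P')"
    "commutation\<^sup>*\<^sup>* ((block_word P' @ suffix_word n ps') @ [s]) (block_word P @ suffix_word n ps)"
    by (rule admissible_descent[OF snoc.prems(1-3) s eq len(1)])
  let ?c = "block_word P' @ suffix_word n ps'"
  have "act d n s ?x = act d n s (act_word d n ?c start)"
    using commutation_act_word[OF *(4), of d n start] eq by (simp only: act_word_append act_word_Cons act_word_Nil)
  then have "?x = act_word d n ?c start"
    by (rule act_inj[OF assms(1) act_word_closed act_word_closed, rotated -1])
      (use assms(1) start_coloured_perms in blast)+
  from snoc.IH[OF *(1-3) w this len(2)] have "commutation\<^sup>*\<^sup>* (w @ [s]) (?c @ [s])"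
    by (rule commutation_append_right)
  then show ?case using *(4) by (rule rtranclp_trans)
qed

lemma canonical_word_gens:
  "P \<in> prefix_blocks n \<Longrightarrow> ps \<in> suffix_data d n \<Longrightarrow> block_word P @ suffix_word n ps \<in> lists (gens n)"
  using set_block_word[of P n] suffix_word_gens[of ps d n] by simp

text \<open>No shorter word can represent the element: a word of length \<open>l\<close> reaches at most length \<open>l\<close> in the
action, and the canonical word reaches its own length.\<close>

lemma canonical_word_minimal:
  assumes "1 \<le> d" "2 \<le> n" "P \<in> prefix_blocks n" "ps \<in> suffix_data d n"
    and "v \<in> lists (gens n)" "element d n v = element d n (block_word P @ suffix_word n ps)"
  shows "length (block_word P @ suffix_word n ps) \<le> length v"
  using len_act_word_le[OF assms(5), of d start] len_canonical_word[OF assms(3,4)]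
    element_eq_act_word[OF assms(6,5,1,2)] by simp

theorem admissible_fully_commutative:
  assumes "1 \<le> d" "2 \<le> n" "P \<in> increasing_blocks n" "ps \<in> suffix_data d n" "admissible n ps (snd ` set P)"
  shows "fully_commutative d n (element d n (block_word P @ suffix_word n ps))"
proof -
  let ?c = "block_word P @ suffix_word n ps"
  have P: "P \<in> prefix_blocks n" by (rule increasing_blocks_prefix[OF assms(3)])
  have "commutation\<^sup>*\<^sup>* u ?c" if u: "u \<in> reduced_expressions d n (element d n ?c)" for u
  proof -
    have u': "u \<in> lists (gens n)" "element d n u = element d n ?c" "length u \<le> length ?c"
      using u canonical_word_gens[OF P assms(4)] unfolding reduced_expressions_def by blast+
    have act: "act_word d n u start = act_word d n ?c start"
      by (rule element_eq_act_word[OF u'(2,1) assms(1,2)])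
    have "len n (act_word d n u start) = length u"
      using act len_canonical_word[OF P assms(4)] canonical_word_minimal[OF assms(1,2) P assms(4) u'(1,2)] u'(3)
      by simp
    then show ?thesis by (rule commutation_admissible[OF assms(1,3-5) u'(1) act])
  qed
  then show ?thesis
    unfolding fully_commutative_def by (meson commutation_sym rtranclp_trans)
qed

section \<open>Braids obstruct full commutativity\<close>

lemma element_context:
  assumes "element d n u = element d n v" "u \<in> lists (gens n)" "p \<in> lists (gens n)" "q \<in> lists (gens n)"
  shows "element d n (p @ u @ q) = element d n (p @ v @ q)"
proof -
  have "pres_eq (gens n) (G_rels d n) (pos u) (pos v)"
    using assms(1,2) by (simp add: element_def pres_class_eq_iff)
  then have "pres_eq (gens n) (G_rels d n) (pos p @ pos u @ pos q) (pos p @ pos v @ pos q)"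
    using assms by (intro pres_eq_context) simp_all
  then show ?thesis using assms by (simp add: element_def pres_class_eq_iff)
qed

lemma element_rel:
  assumes "(l, r) \<in> G_rels d n" "l \<in> lists (gens n)" "r \<in> lists (gens n)"
  shows "element d n l = element d n r"
  using pres_rel[of "[]" "gens n" "[]" l r "G_rels d n"] assms
  by (simp add: element_def pres_class_eq_iff)

lemma commutation_element:
  assumes "commutation\<^sup>*\<^sup>* u v" "u \<in> lists (gens n)"
  shows "element d n u = element d n v"
  using assms
proof (induction rule: rtranclp_induct)
  case (step y z)
  have "y \<in> lists (gens n)" using commutation_gens[OF step.hyps(1)] step.prems by blast
  moreover have "element d n y = element d n z" using step.hyps(2) calculation
  proof cases
    case (1 j i a b)
    have ij: "1 \<le> i" "i \<le> n" "1 \<le> j" "j \<le> n" and ab: "a \<in> lists (gens n)" "b \<in> lists (gens n)"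
      using \<open>y \<in> lists (gens n)\<close> by (auto simp: 1 gens_def)
    have "([i, j], [j, i]) \<in> G_rels d n \<or> ([j, i], [i, j]) \<in> G_rels d n"
      using 1(3) ij by (auto simp: G_rels_def)
    then have "element d n [i, j] = element d n [j, i]"
      using element_rel[of "[i, j]" "[j, i]" d n] element_rel[of "[j, i]" "[i, j]" d n] ij by (auto simp: gens_def)
    then show ?thesis unfolding 1 using ij ab by (intro element_context) (simp_all add: gens_def)
  qed
  ultimately show ?case using step by simp
qed simp

lemma element_braid:
  assumes "1 \<le> i" "i + 2 \<le> n" "a \<in> lists (gens n)" "b \<in> lists (gens n)"
  shows "element d n (a @ [i, i + 1, i] @ b) = element d n (a @ [i + 1, i, i + 1] @ b)"
proof -
  have "([i + 1, i, i + 1], [i, i + 1, i]) \<in> G_rels d n" using assms by (auto simp: G_rels_def)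
  from element_rel[OF this] show ?thesis
    using assms by (intro element_context) (auto simp: gens_def)
qed

text \<open>The relation \<open>s\<^sub>n c = c s\<^sub>n\<close> for \<open>c = s\<^sub>m s\<^sub>n s\<^sub>m\<close> is the braid relation of length four, as
\<open>s\<^sub>m\<^sup>2 = 1\<close>.  Hence \<open>s\<^sub>n\<close> commutes with \<open>c\<^sup>a = s\<^sub>m s\<^sub>n\<^sup>a s\<^sub>m\<close>.\<close>

lemma element_conjugate_power_commute:
  assumes n: "n = m + 1" "1 \<le> m"
  shows "element d n (m # replicate a n @ [m, n]) = element d n (n # m # replicate a n @ [m])"
proof (induction a)
  case 0
  have "element d n [m, m] = element d n []"
    using n by (intro element_rel) (auto simp: G_rels_def gens_def)
  from element_context[OF this, of "[]" "[n]"] element_context[OF this, of "[n]" "[]"] show ?case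
    using n by (simp add: gens_def)
next
  case (Suc a)
  have mn: "m \<in> gens n" "n \<in> gens n" using n by (auto simp: gens_def)
  have r: "set (replicate k n) \<subseteq> gens n" for k using mn by (cases k) auto
  have sq: "element d n [m, m] = element d n []"
    using n by (intro element_rel) (auto simp: G_rels_def gens_def)
  have br: "element d n [n, m, n, m] = element d n [m, n, m, n]"
    using n by (intro element_rel) (auto simp: G_rels_def gens_def)
  let ?w = "m # replicate a n"
  have w: "?w \<in> lists (gens n)" using mn r by (auto simp: in_lists_conv_set)
  have "m # replicate (Suc a) n @ [m, n] = ?w @ [] @ [n, m, n]"
    by (simp add: replicate_app_Cons_same)
  \<comment> \<open>insert \<open>s\<^sub>m\<^sup>2 = 1\<close> to make room for the relation of length four\<close>
  also have "element d n \<dots> = element d n (?w @ [m, m] @ [n, m, n])"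
    using w mn by (intro element_context sq[symmetric]) simp_all
  also have "?w @ [m, m] @ [n, m, n] = (?w @ [m]) @ [m, n, m, n] @ []" by simp
  also have "element d n \<dots> = element d n ((?w @ [m]) @ [n, m, n, m] @ [])"
    using w mn by (intro element_context br[symmetric]) simp_all
  also have "(?w @ [m]) @ [n, m, n, m] @ [] = [] @ (m # replicate a n @ [m, n]) @ [m, n, m]" by simp
  also have "element d n \<dots> = element d n ([] @ (n # m # replicate a n @ [m]) @ [m, n, m])"
    using w mn by (intro element_context Suc.IH) simp_all
  also have "[] @ (n # m # replicate a n @ [m]) @ [m, n, m] = (n # ?w) @ [m, m] @ [n, m]" by simp
  also have "element d n \<dots> = element d n ((n # ?w) @ [] @ [n, m])"
    using w mn by (intro element_context sq) simp_all
  also have "(n # ?w) @ [] @ [n, m] = n # m # replicate (Suc a) n @ [m]"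
    by (simp add: replicate_app_Cons_same)
  finally show ?case .
qed

text \<open>For \<open>a \<ge> 2\<close> no factor of the left word has the form \<open>s\<^sub>m s\<^sub>n s\<^sub>m s\<^sub>n\<close> or \<open>s\<^sub>n s\<^sub>m s\<^sub>n s\<^sub>m\<close>, although both words
have the same length; the proof passes through longer words.\<close>

lemma element_conjugate_powers_commute:
  assumes n: "n = m + 1" "1 \<le> m"
  shows "element d n (m # replicate a n @ m # replicate b n) = element d n (replicate b n @ m # replicate a n @ [m])"
proof (induction b)
  case (Suc b)
  have mn: "m \<in> gens n" "n \<in> gens n" using n by (auto simp: gens_def)
  have r: "set (replicate k n) \<subseteq> gens n" for k using mn by (cases k) auto
  let ?w = "m # replicate a n"
  have w: "?w \<in> lists (gens n)" "replicate b n \<in> lists (gens n)"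
    using mn r by (auto simp: in_lists_conv_set)
  have "m # replicate a n @ m # replicate (Suc b) n = [] @ (m # replicate a n @ m # replicate b n) @ [n]"
    by (simp add: replicate_append_same)
  also have "element d n \<dots> = element d n ([] @ (replicate b n @ m # replicate a n @ [m]) @ [n])"
    using w mn by (intro element_context Suc.IH) simp_all
  also have "[] @ (replicate b n @ m # replicate a n @ [m]) @ [n] = replicate b n @ (m # replicate a n @ [m, n]) @ []"
    by simp
  also have "element d n \<dots> = element d n (replicate b n @ (n # m # replicate a n @ [m]) @ [])"
    using w mn by (intro element_context element_conjugate_power_commute n) simp_all
  also have "replicate b n @ (n # m # replicate a n @ [m]) @ [] = replicate (Suc b) n @ m # replicate a n @ [m]"
    by (simp add: replicate_app_Cons_same)
  finally show ?case .
qed simp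

lemma fully_commutative_commutation:
  assumes "1 \<le> d" "2 \<le> n" "P \<in> prefix_blocks n" "ps \<in> suffix_data d n"
    and "fully_commutative d n (element d n (block_word P @ suffix_word n ps))"
    and "v \<in> lists (gens n)" "element d n v = element d n (block_word P @ suffix_word n ps)"
    and "length v = length (block_word P @ suffix_word n ps)"
  shows "commutation\<^sup>*\<^sup>* (block_word P @ suffix_word n ps) v"
proof -
  let ?c = "block_word P @ suffix_word n ps"
  have min: "length ?c \<le> length u" if "u \<in> lists (gens n)" "element d n u = element d n ?c" for u
    by (rule canonical_word_minimal[OF assms(1-4) that])
  have "?c \<in> reduced_expressions d n (element d n ?c)"
    using canonical_word_gens[OF assms(3,4)] min unfolding reduced_expressions_def by blast
  moreover have "v \<in> reduced_expressions d n (element d n ?c)"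
    using assms(6-8) min unfolding reduced_expressions_def by simp
  ultimately show ?thesis using assms(5) unfolding fully_commutative_def by blast
qed

text \<open>Replacing the braid gives another reduced word, in which the letter \<open>i\<close> occurs once less.\<close>

lemma fully_commutative_no_braid:
  assumes "1 \<le> d" "2 \<le> n" "P \<in> prefix_blocks n" "ps \<in> suffix_data d n"
    and "fully_commutative d n (element d n (block_word P @ suffix_word n ps))"
    and "1 \<le> i" "i + 2 \<le> n"
  shows "\<not> commutation\<^sup>*\<^sup>* (block_word P @ suffix_word n ps) (a @ [i, i + 1, i] @ b)"
proof
  let ?c = "block_word P @ suffix_word n ps"
  assume c: "commutation\<^sup>*\<^sup>* ?c (a @ [i, i + 1, i] @ b)"
  have cg: "?c \<in> lists (gens n)" by (rule canonical_word_gens[OF assms(3,4)])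
  then have ab: "a \<in> lists (gens n)" "b \<in> lists (gens n)"
    using commutation_gens[OF c] by auto
  let ?v = "a @ [i + 1, i, i + 1] @ b"
  have "element d n ?v = element d n ?c"
    using element_braid[OF assms(6,7) ab] commutation_element[OF c cg, of d] by simp
  moreover have "?v \<in> lists (gens n)" using ab assms(6,7) by (simp add: gens_def)
  moreover have "length ?v = length ?c" using commutation_length[OF c] by simp
  ultimately have cv: "commutation\<^sup>*\<^sup>* ?c ?v"
    by (intro fully_commutative_commutation[OF assms(1-5)])
  have "count_list ?v i = count_list (a @ [i, i + 1, i] @ b) i"
    using commutation_count_list[OF cv, of i] commutation_count_list[OF c, of i] by (rule trans[OF sym])
  then show False by simp
qed

text \<open>Here the two words have the same letters, but the letters \<open>m\<close>, \<open>n\<close> appear in a different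
order.\<close>

lemma fully_commutative_no_long_braid:
  assumes "1 \<le> d" "2 \<le> n" "P \<in> prefix_blocks n" "ps \<in> suffix_data d n"
    and "fully_commutative d n (element d n (block_word P @ suffix_word n ps))"
    and "n = m + 1" "1 \<le> s" "1 \<le> t"
  shows "\<not> commutation\<^sup>*\<^sup>* (block_word P @ suffix_word n ps) (a @ (m # replicate s n @ m # replicate t n) @ b)"
proof
  let ?c = "block_word P @ suffix_word n ps"
  let ?w = "a @ (m # replicate s n @ m # replicate t n) @ b"
  assume c: "commutation\<^sup>*\<^sup>* ?c ?w"
  have m: "1 \<le> m" using assms(2,6) by simp
  have cg: "?c \<in> lists (gens n)" by (rule canonical_word_gens[OF assms(3,4)])
  then have w: "?w \<in> lists (gens n)" using commutation_gens[OF c] by blast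
  let ?v = "a @ (replicate t n @ m # replicate s n @ [m]) @ b"
  have "element d n ?w = element d n ?v"
    using w by (intro element_context element_conjugate_powers_commute assms(6) m) simp_all
  then have "element d n ?v = element d n ?c"
    using commutation_element[OF c cg, of d] by simp
  moreover have "?v \<in> lists (gens n)" using w by (auto simp: in_lists_conv_set)
  moreover have "length ?v = length ?c" using commutation_length[OF c] by simp
  ultimately have cv: "commutation\<^sup>*\<^sup>* ?c ?v"
    by (intro fully_commutative_commutation[OF assms(1-5)])
  have "filter (\<lambda>k. k = m \<or> k = Suc m) ?v = filter (\<lambda>k. k = m \<or> k = Suc m) ?w"
    using commutation_filter[OF cv, of m] commutation_filter[OF c, of m] by (rule trans[OF sym])
  then show False using assms(6-8) by (cases t) auto
qed

lemma s_desc_split_pair: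
  assumes "1 \<le> j" "j \<le> m" "Suc m \<le> p"
  shows "s_desc p j = s_desc p (m + 2) @ [m + 1, m] @ s_desc (m - 1) j"
  using assms s_desc_split[of j "Suc m" p] s_desc_greater[of j "Suc m"] s_desc_split[of j "m - 1" m]
  by (simp add: s_desc_same)

lemma not_sorted_adjacent:
  "\<not> sorted_wrt (\<lambda>x y. f x < (f y :: 'b::linorder)) xs \<Longrightarrow> \<exists>as x y bs. xs = as @ x # y # bs \<and> f y \<le> f x"
proof (induction xs)
  case (Cons x xs)
  show ?case
  proof (cases "sorted_wrt (\<lambda>x y. f x < f y) xs")
    case True
    then obtain z where z: "z \<in> set xs" "f z \<le> f x" using Cons.prems by force
    then obtain y ys where xs: "xs = y # ys" by (cases xs) auto
    then have "f y \<le> f x" using True z by force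
    then show ?thesis unfolding xs by (metis append_Nil)
  next
    case False
    from Cons.IH[OF this] show ?thesis by (metis append_Cons)
  qed
qed simp

text \<open>If \<open>s\<^bsub>p i\<^esub> s\<^bsub>q j\<^esub>\<close> are consecutive factors with \<open>j \<le> i\<close>, the last letter \<open>s\<^sub>i\<close> of the first one
commutes forward until it meets \<open>s\<^bsub>i+1\<^esub> s\<^sub>i\<close> in the second one.\<close>

lemma fully_commutative_increasing:
  assumes "1 \<le> d" "2 \<le> n" "P \<in> prefix_blocks n" "ps \<in> suffix_data d n"
    and "fully_commutative d n (element d n (block_word P @ suffix_word n ps))"
  shows "P \<in> increasing_blocks n"
proof (rule ccontr)
  assume "P \<notin> increasing_blocks n"
  then have "\<not> sorted_wrt (\<lambda>x y. snd x < snd y) P" using assms(3) by (simp add: increasing_blocks_def)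
  from not_sorted_adjacent[OF this] obtain A p i q j B where P: "P = A @ (p, i) # (q, j) # B" and "j \<le> i"
    by auto
  have *: "1 \<le> j" "i \<le> p" "p < q" "q < n"
    using assms(3) by (auto simp: P prefix_blocks_def sorted_wrt_append)
  let ?a = "block_word A @ s_desc p (Suc i)"
  let ?b = "s_desc (i - 1) j @ block_word B @ suffix_word n ps"
  have "block_word P @ suffix_word n ps = ?a @ (i # s_desc q (i + 2)) @ [i + 1, i] @ ?b"
    using s_desc_split_pair[of j i q] s_desc_snoc[of i p] * \<open>j \<le> i\<close> by (simp add: P)
  moreover have "commutation\<^sup>*\<^sup>* (i # s_desc q (i + 2)) (s_desc q (i + 2) @ [i])"
    by (rule commutation_move) (auto simp: set_s_desc)
  from commutation_context[OF this, of ?a "[i + 1, i] @ ?b"]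
  have "commutation\<^sup>*\<^sup>* (?a @ (i # s_desc q (i + 2)) @ [i + 1, i] @ ?b)
      ((?a @ s_desc q (i + 2)) @ [i, i + 1, i] @ ?b)"
    by simp
  ultimately have "commutation\<^sup>*\<^sup>* (block_word P @ suffix_word n ps)
      ((?a @ s_desc q (i + 2)) @ [i, i + 1, i] @ ?b)"
    by simp
  moreover have "1 \<le> i" "i + 2 \<le> n" using * \<open>j \<le> i\<close> by auto
  ultimately show False using fully_commutative_no_braid[OF assms] by blast
qed

text \<open>The descent \<open>s\<^sub>m\<close> moves to the end of the prefix and, if \<open>m \<le> n - 2\<close>, on to the letters
\<open>s\<^bsub>m+1\<^esub> s\<^sub>m\<close> of the first suffix factor.  If \<open>m = n - 1\<close>, it stops at \<open>s\<^sub>n\<^sup>t s\<^bsub>n-1\<^esub>\<close>, and the power of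
\<open>s\<^sub>n\<close> from the second suffix factor moves left to complete the long braid.\<close>

lemma descent_not_fully_commutative:
  assumes "1 \<le> d" "2 \<le> n" "P \<in> increasing_blocks n" "(t, j) # ps \<in> suffix_data d n"
    and "m \<in> snd ` set P" "m + 1 \<notin> snd ` set P" "j \<le> m" "m + 2 \<le> n \<or> ps \<noteq> []"
  shows "\<not> fully_commutative d n (element d n (block_word P @ suffix_word n ((t, j) # ps)))"
proof
  assume fc: "fully_commutative d n (element d n (block_word P @ suffix_word n ((t, j) # ps)))"
  have P: "P \<in> prefix_blocks n" by (rule increasing_blocks_prefix[OF assms(3)])
  have mn: "m < n" using prefix_blocksD[OF P, of _ m] assms(5) by fastforce
  have j: "1 \<le> j" "1 \<le> t" using assms(4) by (auto simp: suffix_data_def)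
  obtain P' where P': "commutation\<^sup>*\<^sup>* (block_word P) (block_word P' @ [m])"
    using remove_descent[OF assms(3,5,6)] by metis
  have c: "commutation\<^sup>*\<^sup>* (block_word P @ suffix_word n ((t, j) # ps))
      ((block_word P' @ [m]) @ suffix_word n ((t, j) # ps))"
    by (rule commutation_append_right[OF P'])
  show False
  proof (cases "m + 2 \<le> n")
    case True
    let ?u = "replicate t n @ s_desc (n - 1) (m + 2)"
    let ?b = "s_desc (m - 1) j @ suffix_word n ps"
    have "suffix_word n ((t, j) # ps) = ?u @ [m + 1, m] @ ?b"
      using s_desc_split_pair[of j m "n - 1"] j(1) assms(7) True by simp
    moreover have "commutation\<^sup>*\<^sup>* (m # ?u) (?u @ [m])"
      using True by (intro commutation_move) (auto simp: set_s_desc)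
    from commutation_context[OF this, of "block_word P'" "[m + 1, m] @ ?b"]
    have "commutation\<^sup>*\<^sup>* ((block_word P' @ [m]) @ ?u @ [m + 1, m] @ ?b) ((block_word P' @ ?u) @ [m, m + 1, m] @ ?b)"
      by simp
    ultimately have "commutation\<^sup>*\<^sup>* (block_word P @ suffix_word n ((t, j) # ps))
        ((block_word P' @ ?u) @ [m, m + 1, m] @ ?b)"
      using c by (simp only: rtranclp_trans[OF c])
    moreover have "1 \<le> m" using j(1) assms(7) by simp
    ultimately show False using fully_commutative_no_braid[OF assms(1,2) P assms(4) fc _ True] by blast
  next
    case False
    then have n: "n = m + 1" using mn by simp
    obtain t' j' qs where ps: "ps = (t', j') # qs" using False assms(8) by (cases ps) auto
    have t': "1 \<le> t'" using assms(4) by (auto simp: ps suffix_data_def)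
    let ?v = "s_desc (m - 1) j"
    let ?b = "s_desc m j' @ suffix_word n qs"
    have "s_desc m j = m # ?v"
      using s_desc_split[of j "m - 1" m] j(1) assms(7) by (simp add: s_desc_same)
    then have "suffix_word n ((t, j) # ps) = (replicate t n @ [m]) @ (?v @ replicate t' n) @ ?b"
      using n by (simp add: ps)
    moreover have "commutation\<^sup>*\<^sup>* (?v @ replicate t' n) (replicate t' n @ ?v)"
      using n j(1) assms(7) by (intro commutation_swap_words) (auto simp: set_s_desc)
    from commutation_context[OF this, of "(block_word P' @ [m]) @ replicate t n @ [m]" ?b]
    have "commutation\<^sup>*\<^sup>* ((block_word P' @ [m]) @ (replicate t n @ [m]) @ (?v @ replicate t' n) @ ?b)
        (block_word P' @ (m # replicate t n @ m # replicate t' n) @ ?v @ ?b)"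
      by simp
    ultimately have "commutation\<^sup>*\<^sup>* (block_word P @ suffix_word n ((t, j) # ps))
        (block_word P' @ (m # replicate t n @ m # replicate t' n) @ ?v @ ?b)"
      using c by (simp only: rtranclp_trans[OF c])
    then show False using fully_commutative_no_long_braid[OF assms(1,2) P assms(4) fc n j(2) t'] by blast
  qed
qed

lemma fully_commutative_admissible:
  assumes "1 \<le> d" "2 \<le> n" "P \<in> prefix_blocks n" "ps \<in> suffix_data d n"
    and fc: "fully_commutative d n (element d n (block_word P @ suffix_word n ps))"
  shows "admissible n ps (snd ` set P)"
proof (cases ps)
  case (Cons p qs)
  obtain t j where p: "p = (t, j)" by (cases p)
  let ?I = "snd ` set P"
  have P: "P \<in> increasing_blocks n" by (rule fully_commutative_increasing[OF assms])
  have no: "m + 1 \<in> ?I" if "m \<in> ?I" "j \<le> m" "m + 2 \<le> n \<or> qs \<noteq> []" for m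
    using descent_not_fully_commutative[OF assms(1,2) P, of t j qs m] assms(4) fc that
    unfolding Cons p by blast
  show ?thesis
  proof (cases "qs = []")
    case True
    then show ?thesis using no by (simp add: Cons p del: image_iff)
  next
    case False
    have "i < j" if "i \<in> ?I" for i
    proof (rule ccontr)
      assume "\<not> i < j"
      \<comment> \<open>the largest last index is a descent, and it is at least \<open>j\<close> if any last index is\<close>
      let ?m = "Max ?I"
      have fin: "finite ?I" by simp
      have "?m \<in> ?I" "i \<le> ?m" using Max_in[OF fin] Max_ge[OF fin that] that by (metis empty_iff)+
      moreover have "?m + 1 \<notin> ?I" using Max_ge[OF fin, of "?m + 1"] by fastforce
      ultimately show False using no[of ?m] \<open>\<not> i < j\<close> False by linarith
    qed
    then show ?thesis using False by (simp add: Cons p admissible_Cons_Cons)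
  qed
qed simp

lemma collection_eq:
  assumes "1 \<le> d" "2 \<le> n" "ps \<in> suffix_data d n"
  shows "collection d n (suffix_word n ps) = (\<lambda>P. block_word P @ suffix_word n ps) `
    {P \<in> increasing_blocks n. admissible n ps (snd ` set P)}" (is "_ = ?f ` ?S")
proof
  show "collection d n (suffix_word n ps) \<subseteq> ?f ` ?S"
  proof
    fix w assume w: "w \<in> collection d n (suffix_word n ps)"
    then obtain P where P: "P \<in> prefix_blocks n" "w = block_word P @ suffix_word n ps"
      by (auto simp: collection_def prefixes_eq_block_words)
    then have fc: "fully_commutative d n (element d n (block_word P @ suffix_word n ps))"
      using w by (simp add: collection_def)
    show "w \<in> ?f ` ?S"
      using P fully_commutative_increasing[OF assms(1,2) P(1) assms(3) fc]
        fully_commutative_admissible[OF assms(1,2) P(1) assms(3) fc] by blast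
  qed
  show "?f ` ?S \<subseteq> collection d n (suffix_word n ps)"
    using admissible_fully_commutative[OF assms(1,2) _ assms(3)] increasing_blocks_prefix assms(3)
    unfolding collection_def canonical_words_def suffixes_def prefixes_eq_block_words by blast
qed

lemma card_collection:
  assumes "1 \<le> d" "2 \<le> n" "ps \<in> suffix_data d n"
  shows "card (collection d n (suffix_word n ps)) =
    card {P \<in> increasing_blocks n. admissible n ps (snd ` set P)}"
  unfolding collection_eq[OF assms]
  by (intro card_image inj_onI) (use block_word_inj in \<open>auto dest: inj_onD\<close>)

section \<open>Equinumerous sets of prefixes\<close>

text \<open>What remains of an increasing prefix when its factors with last index at least \<open>k\<close> are removed, if
the first one of these starts with \<open>s\<^sub>m\<close>.\<close>

definition short_blocks :: "nat \<Rightarrow> nat \<Rightarrow> (nat \<times> nat) list set" where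
  "short_blocks k m = {Q \<in> increasing_blocks m. \<forall>(p, i) \<in> set Q. i < k}"

text \<open>The factors of \<open>s\<^sub>m s\<^bsub>m+1\<^esub> \<dots> s\<^bsub>n-1\<^esub>\<close>.\<close>

definition diagonal_blocks :: "nat \<Rightarrow> nat \<Rightarrow> (nat \<times> nat) list" where
  "diagonal_blocks n m = map (\<lambda>x. (x, x)) [m..<n]"

text \<open>The last indices exhaust an interval \<open>{m..n-1}\<close>, and the first indices are at least as large, increasing
and at most \<open>n - 1\<close>, so there is no room for them to differ from the last ones.\<close>

lemma diagonal_tail:
  assumes "sorted_wrt (\<lambda>x y. fst x < fst y) R" "sorted_wrt (\<lambda>x y. snd x < snd y) R"
    and "\<And>p i. (p, i) \<in> set R \<Longrightarrow> i \<le> p \<and> p < n"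
    and "\<And>i. i \<in> snd ` set R \<Longrightarrow> i + 2 \<le> n \<Longrightarrow> i + 1 \<in> snd ` set R"
    and "R \<noteq> []"
  shows "R = diagonal_blocks n (snd (hd R))"
  using assms
proof (induction R)
  case (Cons b R)
  obtain p i where b: "b = (p, i)" by (cases b)
  have pi: "i \<le> p" "p < n" using Cons.prems(3)[of p i] by (auto simp: b)
  show ?case
  proof (cases "R = []")
    case True
    then have "\<not> i + 2 \<le> n" using Cons.prems(4)[of i] by (auto simp: b)
    then have "p = i" "n = Suc i" using pi by auto
    then show ?thesis by (simp add: True b diagonal_blocks_def)
  next
    case False
    have "j + 1 \<in> snd ` set R" if "j \<in> snd ` set R" "j + 2 \<le> n" for j
    proof -
      have "i < j" using Cons.prems(2) that(1) by (auto simp: b)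
      then show ?thesis using Cons.prems(4)[of j] that by (auto simp: b)
    qed
    then have R: "R = diagonal_blocks n (snd (hd R))"
      using Cons.prems False by (intro Cons.IH) auto
    let ?m = "snd (hd R)"
    have m: "?m < n"
    proof (rule ccontr)
      assume "\<not> ?m < n"
      then have "diagonal_blocks n ?m = []" by (simp add: diagonal_blocks_def)
      then show False using R False by metis
    qed
    have "hd R = hd (diagonal_blocks n ?m)" using R by (rule arg_cong)
    then have hd: "hd R = (?m, ?m)" using m by (simp add: diagonal_blocks_def upt_conv_Cons)
    have mR: "(?m, ?m) \<in> set R" using False hd by (metis hd_in_set)
    have less: "i < ?m" "p < ?m"
      using Cons.prems(1,2) bspec[OF _ mR, of "\<lambda>y. fst b < fst y"] bspec[OF _ mR, of "\<lambda>y. snd b < snd y"]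
      by (simp_all add: b)
    have "i + 1 \<in> snd ` set (b # R)" using less m by (intro Cons.prems(4)) (auto simp: b)
    then have "i + 1 \<in> snd ` set R" by (auto simp: b)
    moreover have "set R = set (diagonal_blocks n ?m)" using R by (rule arg_cong)
    ultimately have "i + 1 \<in> snd ` set (diagonal_blocks n ?m)" by (simp only:)
    then have "?m \<le> i + 1" by (auto simp: diagonal_blocks_def)
    then have "?m = Suc i" "p = i" using less pi by auto
    then have "R = diagonal_blocks n (Suc i)" using R by metis
    then show ?thesis
      using \<open>p = i\<close> pi by (simp add: b diagonal_blocks_def upt_conv_Cons)
  qed
qed simp

lemma inj_diagonal_completion:
  "inj_on (\<lambda>(m, Q). Q @ diagonal_blocks n m) (SIGMA m:{k..n}. short_blocks k m)"
proof (rule inj_onI, clarify)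
  fix m Q m' Q'
  assume *: "m \<in> {k..n}" "Q \<in> short_blocks k m" "m' \<in> {k..n}" "Q' \<in> short_blocks k m'"
    and eq: "Q @ diagonal_blocks n m = Q' @ diagonal_blocks n m'"
  have f: "filter (\<lambda>b. snd b < k) (Q @ diagonal_blocks n m) = Q"
    if "m \<in> {k..n}" "Q \<in> short_blocks k m" for m Q
  proof -
    have "filter (\<lambda>b. snd b < k) Q = Q" using that(2) by (auto simp: short_blocks_def filter_id_conv)
    moreover have "filter (\<lambda>b. snd b < k) (diagonal_blocks n m) = []"
      using that(1) by (auto simp: diagonal_blocks_def filter_empty_conv)
    ultimately show ?thesis by simp
  qed
  from arg_cong[OF eq, of "filter (\<lambda>b. snd b < k)"] have "Q = Q'"
    by (simp only: f[OF *(1,2)] f[OF *(3,4)])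
  moreover have "n - m = n - m'"
    using arg_cong[OF eq, of length] \<open>Q = Q'\<close> by (simp add: diagonal_blocks_def)
  ultimately show "m = m' \<and> Q = Q'" using *(1,3) by auto
qed

lemma inj_single_completion:
  "inj_on (\<lambda>(m, Q). if m = n then Q else Q @ [(m, k)]) (SIGMA m:{k..n}. short_blocks k m)"
proof (rule inj_onI, clarify)
  fix m Q m' Q'
  assume *: "m \<in> {k..n}" "Q \<in> short_blocks k m" "m' \<in> {k..n}" "Q' \<in> short_blocks k m'"
    and eq: "(if m = n then Q else Q @ [(m, k)]) = (if m' = n then Q' else Q' @ [(m', k)])"
  have f: "filter (\<lambda>b. snd b < k) (if m = n then Q else Q @ [(m, k)]) = Q"
    if "Q \<in> short_blocks k m" for m Q
    using that by (auto simp: short_blocks_def filter_id_conv)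
  from arg_cong[OF eq, of "filter (\<lambda>b. snd b < k)"] have "Q = Q'"
    by (simp only: f[OF *(2)] f[OF *(4)])
  then show "m = m' \<and> Q = Q'" using eq by (auto split: if_splits)
qed

text \<open>A prefix without descents in \<open>{k..n-2}\<close> is a pair \<open>(m, Q)\<close>: \<open>Q\<close> collects the factors with last
index below \<open>k\<close>, and the others must form the diagonal from \<open>m\<close> to \<open>n - 1\<close>, which is empty for \<open>m = n\<close>.\<close>

lemma admissible_single_eq_image:
  assumes "1 \<le> k" "k \<le> n"
  shows "{P \<in> increasing_blocks n. admissible n [(t, k)] (snd ` set P)} =
    (\<lambda>(m, Q). Q @ diagonal_blocks n m) ` (SIGMA m:{k..n}. short_blocks k m)" (is "?L = ?f ` ?Z")
proof
  show "?f ` ?Z \<subseteq> ?L"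
  proof clarify
    fix m Q assume m: "m \<in> {k..n}" and Q: "Q \<in> short_blocks k m"
    have "sorted_wrt (\<lambda>x y. fst x < fst y) (diagonal_blocks n m)"
      "sorted_wrt (\<lambda>x y. snd x < snd y) (diagonal_blocks n m)"
      by (simp_all add: diagonal_blocks_def sorted_wrt_map)
    moreover have "p = i \<and> m \<le> i \<and> i < n" if "(p, i) \<in> set (diagonal_blocks n m)" for p i
      using that by (auto simp: diagonal_blocks_def)
    moreover have "1 \<le> i \<and> i \<le> p \<and> p < m \<and> i < k" if "(p, i) \<in> set Q" for p i
      using Q that by (auto simp: short_blocks_def increasing_blocks_def prefix_blocks_def)
    ultimately have "Q @ diagonal_blocks n m \<in> increasing_blocks n"
      using Q m assms by (fastforce simp: short_blocks_def increasing_blocks_def prefix_blocks_def sorted_wrt_append)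
    moreover have "i + 1 \<in> snd ` set (Q @ diagonal_blocks n m)"
      if "i \<in> snd ` set (Q @ diagonal_blocks n m)" "k \<le> i" "i + 2 \<le> n" for i
    proof -
      have "i \<notin> snd ` set Q" using Q that(2) by (fastforce simp: short_blocks_def)
      then have "m \<le> i" using that(1) by (auto simp: diagonal_blocks_def)
      then have "(i + 1, i + 1) \<in> set (Q @ diagonal_blocks n m)"
        using that(3) by (auto simp: diagonal_blocks_def)
      from imageI[OF this, of snd] show ?thesis by simp
    qed
    ultimately show "Q @ diagonal_blocks n m \<in> increasing_blocks n \<and>
        admissible n [(t, k)] (snd ` set (Q @ diagonal_blocks n m))"
      by (simp del: set_append)
  qed
  show "?L \<subseteq> ?f ` ?Z"
  proof
    fix P assume "P \<in> ?L"
    then have P: "P \<in> increasing_blocks n"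
      and adm: "\<And>i. i \<in> snd ` set P \<Longrightarrow> k \<le> i \<Longrightarrow> i + 2 \<le> n \<Longrightarrow> i + 1 \<in> snd ` set P"
      by auto
    let ?Q = "takeWhile (\<lambda>b. snd b < k) P"
    let ?R = "dropWhile (\<lambda>b. snd b < k) P"
    have split: "P = ?Q @ ?R" by simp
    have Q: "snd b < k" if "b \<in> set ?Q" for b using set_takeWhileD[OF that] by simp
    have sorted: "sorted_wrt (\<lambda>x y. fst x < fst y) (?Q @ ?R)" "sorted_wrt (\<lambda>x y. snd x < snd y) (?Q @ ?R)"
      using P by (simp_all add: increasing_blocks_def prefix_blocks_def)
    have Q_short: "?Q \<in> short_blocks k m" if "\<And>p i. (p, i) \<in> set ?Q \<Longrightarrow> p < m" for m
    proof -
      have "1 \<le> i \<and> i \<le> p \<and> p < m \<and> i < k" if "(p, i) \<in> set ?Q" for p i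
        using prefix_blocksD[OF increasing_blocks_prefix[OF P], of p i] set_takeWhileD[OF that]
          \<open>\<And>p i. (p, i) \<in> set ?Q \<Longrightarrow> p < m\<close>[OF that] by simp
      moreover have "sorted_wrt (\<lambda>x y. fst x < fst y) ?Q" "sorted_wrt (\<lambda>x y. snd x < snd y) ?Q"
        using sorted unfolding sorted_wrt_append by blast+
      ultimately show ?thesis
        unfolding short_blocks_def increasing_blocks_def prefix_blocks_def by blast
    qed
    show "P \<in> ?f ` ?Z"
    proof (cases "?R = []")
      case True
      have "?Q \<in> short_blocks k n"
      proof (rule Q_short)
        fix p i assume "(p, i) \<in> set ?Q"
        from set_takeWhileD[OF this] show "p < n"
          using prefix_blocksD[OF increasing_blocks_prefix[OF P]] by blast
      qed
      moreover have "diagonal_blocks n n = []" by (simp add: diagonal_blocks_def)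
      then have "P = ?Q @ diagonal_blocks n n" using split by (simp only: True)
      ultimately show ?thesis using assms(2) by (intro image_eqI[of _ ?f "(n, ?Q)"]) simp_all
    next
      case False
      let ?m = "snd (hd ?R)"
      have R: "k \<le> snd b" if "b \<in> set ?R" for b
      proof -
        have "k \<le> ?m" using hd_dropWhile[OF False] by simp
        moreover have "?m \<le> snd b"
          using sorted(2) that False by (cases ?R) (auto simp: sorted_wrt_append simp del: takeWhile_dropWhile_id)
        ultimately show ?thesis by simp
      qed
      have "i + 1 \<in> snd ` set ?R" if "i \<in> snd ` set ?R" "i + 2 \<le> n" for i
      proof -
        have "k \<le> i" "i \<in> snd ` set P" using R that(1) by (auto dest: set_dropWhileD)
        then have "i + 1 \<in> snd ` set (?Q @ ?R)" using adm that(2) by simp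
        then show ?thesis using Q \<open>k \<le> i\<close> unfolding set_append by fastforce
      qed
      moreover have "i \<le> p \<and> p < n" if "(p, i) \<in> set ?R" for p i
        using prefix_blocksD[OF increasing_blocks_prefix[OF P]] set_dropWhileD[OF that] by blast
      moreover have "sorted_wrt (\<lambda>x y. fst x < fst y) ?R" "sorted_wrt (\<lambda>x y. snd x < snd y) ?R"
        using sorted unfolding sorted_wrt_append by blast+
      ultimately have diag: "?R = diagonal_blocks n ?m"
        using False by (intro diagonal_tail)
      have hd: "hd ?R \<in> set ?R" using False by simp
      then have "hd ?R \<in> set (diagonal_blocks n ?m)" using arg_cong[OF diag, of set] by (simp only:)
      then have m: "?m < n" "fst (hd ?R) = ?m" by (auto simp: diagonal_blocks_def)
      have "?Q \<in> short_blocks k ?m"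
        using sorted(1) hd unfolding sorted_wrt_append m(2)[symmetric] by (intro Q_short) fastforce
      moreover have "P = ?f (?m, ?Q)" using split diag by (simp only: case_prod_conv)
      moreover have "?m \<in> {k..n}" using R[OF hd] m by simp
      ultimately show ?thesis by (intro image_eqI[of _ ?f "(?m, ?Q)"]) simp_all
    qed
  qed
qed

text \<open>The same pairs \<open>(m, Q)\<close> parametrize the prefixes with all last indices at most \<open>k\<close>, since at most
the last factor can have last index \<open>k\<close>; now \<open>m\<close> is the first index of this factor, and \<open>m = n\<close> says that there
is none.\<close>

lemma bounded_eq_image:
  assumes "1 \<le> k" "k \<le> n"
  shows "{P \<in> increasing_blocks n. \<forall>i \<in> snd ` set P. i < k + 1} =
    (\<lambda>(m, Q). if m = n then Q else Q @ [(m, k)]) ` (SIGMA m:{k..n}. short_blocks k m)" (is "?L = ?f ` ?Z")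
proof
  show "?f ` ?Z \<subseteq> ?L"
  proof clarify
    fix m Q assume m: "m \<in> {k..n}" and Q: "Q \<in> short_blocks k m"
    then have Qm: "Q \<in> increasing_blocks m" "\<forall>(p, i) \<in> set Q. i < k" by (simp_all add: short_blocks_def)
    have less: "p < m" if "(p, i) \<in> set Q" for p i
      using prefix_blocksD[OF increasing_blocks_prefix[OF Qm(1)] that] by simp
    have "Q \<in> increasing_blocks n"
      using Qm(1) m by (fastforce simp: increasing_blocks_def prefix_blocks_def)
    then show "(if m = n then Q else Q @ [(m, k)]) \<in> increasing_blocks n \<and>
        (\<forall>i \<in> snd ` set (if m = n then Q else Q @ [(m, k)]). i < k + 1)"
      using m Qm(2) less assms by (auto simp: increasing_blocks_snoc)
  qed
  show "?L \<subseteq> ?f ` ?Z"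
  proof
    fix P assume "P \<in> ?L"
    then have P: "P \<in> increasing_blocks n" and le: "\<And>p i. (p, i) \<in> set P \<Longrightarrow> i \<le> k"
      by force+
    show "P \<in> ?f ` ?Z"
    proof (cases "k \<in> snd ` set P")
      case False
      then have "i < k" if "(p, i) \<in> set P" for p i
        using le[OF that] that by (metis image_eqI le_neq_implies_less snd_conv)
      then have "(n, P) \<in> ?Z" using P assms(2) by (auto simp: short_blocks_def)
      then show ?thesis by force
    next
      case True
      then obtain Q b where Qb: "P = Q @ [b]" by (cases P rule: rev_cases) auto
      obtain m j where b: "b = (m, j)" by (cases b)
      have *: "Q \<in> increasing_blocks n" "j \<le> m" "m < n" "\<forall>(q, i) \<in> set Q. q < m \<and> i < j"
        using P by (simp_all add: Qb b increasing_blocks_snoc)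
      have "j = k" using True le[of m j] *(4) by (fastforce simp: Qb b)
      then have "(m, Q) \<in> ?Z"
        using * by (fastforce simp: short_blocks_def increasing_blocks_def prefix_blocks_def)
      moreover have "P = ?f (m, Q)" using *(3) \<open>j = k\<close> by (simp add: Qb b)
      ultimately show ?thesis by (rule rev_image_eqI)
    qed
  qed
qed

lemma card_single_eq_card_bounded:
  assumes "1 \<le> k" "k \<le> n"
  shows "card {P \<in> increasing_blocks n. admissible n [(t, k)] (snd ` set P)} =
    card {P \<in> increasing_blocks n. \<forall>i \<in> snd ` set P. i < k + 1}"
  unfolding admissible_single_eq_image[OF assms] bounded_eq_image[OF assms]
  by (simp add: card_image inj_diagonal_completion inj_single_completion)

lemma admissible_long:
  assumes "2 \<le> length ps" "snd (hd ps) = j"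
  shows "admissible n ps I \<longleftrightarrow> (\<forall>i \<in> I. i < j)"
proof (cases ps)
  case (Cons p qs)
  moreover from this assms(1) have "qs \<noteq> []" by auto
  ultimately show ?thesis using assms(2) by (simp add: admissible_Cons_Cons)
qed (use assms in simp)

theorem corollary4p6:
  fixes d n k :: nat
  assumes "1 \<le> d" and "2 \<le> n" and "k \<le> n"
  shows "\<forall>C \<in> packet d n k. \<forall>C' \<in> packet d n k. card C = card C'"
proof -
  \<comment> \<open>the common cardinality; for \<open>k = 0\<close> the bound leaves only the empty prefix\<close>
  let ?bounded = "{P \<in> increasing_blocks n. \<forall>i \<in> snd ` set P. i < k + 1}"
  let ?c = "if k + 2 \<le> n then card ?bounded
    else if k + 1 = n then card (increasing_blocks n) else card (collection d n [])"
  have "card (collection d n (suffix_word n ps)) = ?c" if ps: "ps \<in> packet_labels d n k" for ps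
  proof -
    have long: "card (collection d n (suffix_word n ps)) = card ?bounded"
      if "ps \<in> suffix_data d n" "2 \<le> length ps" "snd (hd ps) = k + 1"
      using card_collection[OF assms(1,2) that(1)] by (simp add: admissible_long[OF that(2,3)])
    consider "k = 0" | "1 \<le> k" "k + 2 \<le> n" | "1 \<le> k" "k + 1 = n" | "k = n"
      using assms(3) by linarith
    then show ?thesis
    proof cases
      case 1
      then show ?thesis using long ps assms(2) by (simp add: packet_labels_def)
    next
      case 2
      show ?thesis
      proof (cases "\<exists>t. ps = [(t, k)] \<and> 1 \<le> t \<and> t < d")
        case True
        then obtain t where t: "ps = [(t, k)]" "1 \<le> t" "t < d" by blast
        then have "ps \<in> suffix_data d n" using 2 by (simp add: suffix_data_def)
        from card_collection[OF assms(1,2) this] card_single_eq_card_bounded[of k n t]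
        show ?thesis using 2 unfolding t(1) by simp
      next
        case False
        then show ?thesis using long ps 2 by (auto simp: packet_labels_def)
      qed
    next
      case 3
      obtain t j where t: "ps = [(t, j)]" "1 \<le> t" "t < d" "j = n \<or> j = n - 1"
        using ps 3 by (auto simp: packet_labels_def)
      then have "ps \<in> suffix_data d n" using assms(2) by (auto simp: suffix_data_def)
      moreover have "admissible n ps I" for I using t(4) assms(2) by (auto simp: t(1))
      ultimately show ?thesis using card_collection[OF assms(1,2), of ps] 3 by simp
    next
      case 4
      then show ?thesis using ps assms(2) by (simp add: packet_labels_def)
    qed
  qed
  then show ?thesis by (simp add: packet_def)
qed

end
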